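(* Let $k\geq 2$, $q\ge1$ be integers, $\mathcal{A}$ as in the context, and for an integer $m\ge2$ and $0\le a\le m-1$ put $\overline{R}_{n,k}(a;m)=\frac1n\sum_{1\le i\le n,\ i\equiv a\pmod m}X_iX_{i+1}$ for the type-$\mathcal{A}$ random walk on $\mathbb{Z}^k$. Then for every integer $r\ge1$ and all $0\le a\le 2^r-1$, almost surely $$\lim_{n\to\infty}\overline{R}_{n,k}(a;2^r)=\frac{1}{2^r}\prod_p\Big(1-\frac{2}{p^k}\Big),$$ and for every prime $p_1\ge3$ and $0\le a\le p_1-1$, almost surely $$\lim_{n\to\infty}\overline{R}_{n,k}(a;p_1)=\begin{cases}\dfrac{p_1^{k-1}-1}{p_1^k-2}\displaystyle\prod_p\Big(1-\frac{2}{p^k}\Big), & a=0\text{ or }a=p_1-1,\\[2mm] \dfrac{p_1^{k-1}}{p_1^k-2}\displaystyle\prod_p\Big(1-\frac{2}{p^k}\Big), & \text{otherwise},\end{cases}$$ where $p$ runs over all primes.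
   Context: $\mathcal{A}=\{\boldsymbol{\alpha}_1,\dots,\boldsymbol{\alpha}_q\}$ is a finite set of vectors $\boldsymbol{\alpha}_t=(\alpha_{t,1},\dots,\alpha_{t,k})$ with $0<\alpha_{t,j}<1$ for all $j$ and $\alpha_{t,1}+\cdots+\alpha_{t,k}=1$. For $\boldsymbol{\alpha}=(\alpha_1,\dots,\alpha_k)$ of this form, a type-$\boldsymbol{\alpha}$ step $\mathbf{w}(\boldsymbol{\alpha})$ is a random vector equal to the $j$-th standard basis vector of $\mathbb{Z}^k$ with probability $\alpha_j$. The type-$\mathcal{A}$ random walk is $\mathbf{p}_0=(0,\dots,0)$, $\mathbf{p}_i=\mathbf{p}_{i-1}+\mathbf{w}(\boldsymbol{\alpha}'_i)$ for $i\ge1$, where at each step a type $\boldsymbol{\alpha}'_i\in\mathcal{A}$ is chosen and the steps are independent. A lattice point $\mathbf{n}=(n_1,\dots,n_k)\in\mathbb{Z}^k$ is visible if there is no other lattice point on the segment joining it to the origin (equivalently $\gcd(n_1,\dots,n_k)=1$). $X_i=1$ if $\mathbf{p}_i$ is visible and $X_i=0$ otherwise. *)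

theory Defs
  imports "HOL-Probability.Probability" "HOL-Computational_Algebra.Primes"
begin

text \<open>Steps are encoded by the index of the standard basis vector: W i w = j means
  the i-th step is e_j (j < k). The walk position after i steps has j-th coordinate
  equal to the number of steps t in {1..i} with W t w = j.\<close>

definition walk_pos :: "(nat \<Rightarrow> 'w \<Rightarrow> nat) \<Rightarrow> nat \<Rightarrow> 'w \<Rightarrow> nat \<Rightarrow> int" where
  "walk_pos W i \<omega> j = int (card {t \<in> {1..i}. W t \<omega> = j})"

definition visible :: "nat \<Rightarrow> (nat \<Rightarrow> int) \<Rightarrow> bool" where
  "visible k v \<longleftrightarrow> Gcd (v ` {..<k}) = 1"

definition Xvis :: "nat \<Rightarrow> (nat \<Rightarrow> 'w \<Rightarrow> nat) \<Rightarrow> nat \<Rightarrow> 'w \<Rightarrow> real" where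
  "Xvis k W i \<omega> = (if visible k (walk_pos W i \<omega>) then 1 else 0)"

definition Rbar :: "nat \<Rightarrow> (nat \<Rightarrow> 'w \<Rightarrow> nat) \<Rightarrow> nat \<Rightarrow> nat \<Rightarrow> nat \<Rightarrow> 'w \<Rightarrow> real" where
  "Rbar k W n a m \<omega> =
     (1 / real n) * (\<Sum>i\<in>{i \<in> {1..n}. i mod m = a mod m}. Xvis k W i \<omega> * Xvis k W (i + 1) \<omega>)"

definition prime_prod :: "nat \<Rightarrow> real" where
  "prime_prod k = (\<Prod>p. if prime p then 1 - 2 / real p ^ k else 1)"

end

theory Submission
  imports Defs "HOL-Real_Asymp.Real_Asymp" "HOL-Number_Theory.Cong"
begin

text \<open>
  The indicator that a prime \<open>p\<close> divides all coordinates of the position is an average of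
  the characters \<open>\<xi>\<close> modulo \<open>p\<close>. As the coordinates after \<open>i\<close> steps sum to \<open>i\<close>, the constant
  \<open>\<xi>\<close> contribute a deterministic term, periodic in \<open>i\<close>. For a character \<open>\<chi>\<close> that is not constant on the
  standard basis, the covariance of its values at times \<open>i < j\<close> is a product of about \<open>j - i\<close> one-step
  means of modulus uniformly less than 1, so a second moment bound along the subsequence
  \<open>m\<^sup>8\<close> gives a strong law. Since no nonconstant character modulo \<open>p\<close> becomes constant after
  multiplication by one of order prime to \<open>p\<close>, the primes \<open>p \<le> y\<close> can be sieved
  out one after the other, which yields the product of local densities.

  For the primes \<open>p > y\<close> it is enough to look at the first coordinate and at \<open>p\<close> dividing \<open>i\<close>. The number of
  such \<open>p\<close> dividing the first coordinate is the sum of \<open>1/p\<close>, whose average over \<open>i\<close> is at most \<open>1/y\<close>, plus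
  characters whose covariances are \<open>O((log j)\<^sup>3 / sqrt (j - i))\<close>, so the same strong law applies.
\<close>

section \<open>A strong law for weakly correlated variables\<close>

text \<open>Nothing is stationary: the types follow an arbitrary sequence in \<open>A\<close>, so no
  ergodic theorem applies and everything is extracted from independence through second moments. For
  a fixed modulus each nonconstant character has one contraction factor valid for all types, and
  covariances decay geometrically. The obstacle is that at time \<open>i\<close> every prime up to
  \<open>i\<close> may matter. For frequency \<open>c/p\<close> the one-step mean has modulus within
  a constant times \<open>(c/p)^2\<close> of 1, so the contraction degenerates as \<open>p\<close>
  grows; after summing over \<open>c\<close> only the rate \<open>1 / sqrt (j - i)\<close> survives,
  with logarithmic losses. The strong law is therefore stated for this weak rate and for slowly
  growing variables, and serves both ranges of primes. Large primes need no limit of their own: a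
  bound on their frequency that tends to 0 as \<open>y\<close> grows suffices. Times
  \<open>i\<close> and \<open>i + 1\<close> can be sieved together because a prime dividing both
  positions would divide both \<open>i\<close> and \<open>i + 1\<close>. For a class modulo a power
  of \<open>p\<close>, only the factor at \<open>p\<close> feels the class.\<close>

lemma sum_inverse_sqrt_le: "(\<Sum>d\<in>{1..n}. 1 / sqrt (real d)) \<le> 2 * sqrt (real n)"
proof (induction n)
  case (Suc n)
  have "1 / sqrt (real (Suc n)) \<le> 2 * sqrt (real (Suc n)) - 2 * sqrt (real n)"
  proof -
    define x y where "x = sqrt (real n)" and "y = sqrt (real (Suc n))"
    have y: "y > 0" "x \<ge> 0" "y\<^sup>2 = x\<^sup>2 + 1" by (auto simp: x_def y_def)
    have "0 \<le> (y - x)\<^sup>2" by simp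
    then have "1 \<le> (2 * y - 2 * x) * y" using y(3) by (simp add: power2_eq_square algebra_simps)
    then have "1 / y \<le> 2 * y - 2 * x" using y by (simp add: divide_le_eq)
    then show ?thesis by (simp add: x_def y_def)
  qed
  then show ?case using Suc by simp
qed simp

lemma sum_inverse_sqrt_dist_le:
  assumes "i \<in> {1..n}"
  shows "(\<Sum>j\<in>{1..n} - {i}. 1 / sqrt \<bar>real i - real j\<bar>) \<le> 4 * sqrt (real n)"
proof -
  have split: "{1..n} - {i} = {1..<i} \<union> {i<..n}" using assms by auto
  have "(\<Sum>j\<in>{1..<i}. 1 / sqrt \<bar>real i - real j\<bar>) = (\<Sum>d\<in>{1..<i}. 1 / sqrt (real d))"
    by (rule sum.reindex_bij_witness[of _ "\<lambda>d. i - d" "\<lambda>j. i - j"]) auto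
  also have "\<dots> \<le> (\<Sum>d\<in>{1..n}. 1 / sqrt (real d))"
    using assms by (intro sum_mono2) auto
  finally have 1: "(\<Sum>j\<in>{1..<i}. 1 / sqrt \<bar>real i - real j\<bar>) \<le> 2 * sqrt (real n)"
    using sum_inverse_sqrt_le[of n] by linarith
  have "(\<Sum>j\<in>{i<..n}. 1 / sqrt \<bar>real i - real j\<bar>) = (\<Sum>d\<in>{1..n-i}. 1 / sqrt (real d))"
    by (rule sum.reindex_bij_witness[of _ "\<lambda>d. i + d" "\<lambda>j. j - i"]) auto
  also have "\<dots> \<le> (\<Sum>d\<in>{1..n}. 1 / sqrt (real d))"
    by (intro sum_mono2) auto
  finally have 2: "(\<Sum>j\<in>{i<..n}. 1 / sqrt \<bar>real i - real j\<bar>) \<le> 2 * sqrt (real n)"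
    using sum_inverse_sqrt_le[of n] by linarith
  have "(\<Sum>j\<in>{1..n} - {i}. 1 / sqrt \<bar>real i - real j\<bar>)
      = (\<Sum>j\<in>{1..<i}. 1 / sqrt \<bar>real i - real j\<bar>) + (\<Sum>j\<in>{i<..n}. 1 / sqrt \<bar>real i - real j\<bar>)"
    unfolding split by (intro sum.union_disjoint) auto
  with 1 2 show ?thesis by linarith
qed

text \<open>A gap between consecutive eighth powers has length \<open>O(m^7)\<close> and its terms
  are \<open>O(sqrt m)\<close>, so crossing it changes the average by \<open>O(1 / sqrt m)\<close>.
  Still, eighth powers are sparse enough for the later second moment bound to be summable.\<close>

lemma average_tendsto_zero_from_subsequence:
  fixes z :: "nat \<Rightarrow> complex"
  assumes z: "\<And>i. i \<ge> 1 \<Longrightarrow> norm (z i) \<le> K * real i powr (1/16)"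
    and sub: "(\<lambda>m. (\<Sum>i\<in>{1..m^8}. z i) / of_nat (m^8)) \<longlonglongrightarrow> 0"
  shows "(\<lambda>n. (\<Sum>i\<in>{1..n}. z i) / of_nat n) \<longlonglongrightarrow> 0"
proof -
  define s where "s n = (\<Sum>i\<in>{1..n}. z i)" for n
  define m where "m n = nat \<lfloor>root 8 (real n)\<rfloor>" for n
  \<comment> \<open>Bounds the average for all \<open>n\<close> from \<open>m^8\<close> to
    \<open>(m+1)^8\<close>: the value at \<open>m^8\<close>, plus the number of further terms times
    their maximal size \<open>K * sqrt (m + 1)\<close>, over \<open>m^8\<close>.\<close>
  define F where "F m = norm (s (m^8) / of_nat (m^8))
      + K * ((real m + 1)^8 - real m^8) * sqrt (real m + 1) / real m^8" for m :: nat
  have K: "K \<ge> 0" using z[of 1] norm_ge_zero[of "z 1"] by (simp del: norm_ge_zero)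
  have m_lim: "filterlim m at_top sequentially"
    unfolding m_def by real_asymp
  have "(\<lambda>m. ((real m + 1)^8 - real m^8) * sqrt (real m + 1) / real m^8) \<longlonglongrightarrow> 0"
    by real_asymp
  then have "(\<lambda>m. K * (((real m + 1)^8 - real m^8) * sqrt (real m + 1) / real m^8)) \<longlonglongrightarrow> K * 0"
    by (intro tendsto_mult tendsto_const)
  then have "(\<lambda>m. K * ((real m + 1)^8 - real m^8) * sqrt (real m + 1) / real m^8) \<longlonglongrightarrow> 0"
    by (simp add: mult.assoc)
  then have "F \<longlonglongrightarrow> 0 + 0" unfolding F_def
    using sub by (intro tendsto_add) (auto simp: s_def intro: tendsto_norm_zero)
  then have F_lim: "(\<lambda>n. F (m n)) \<longlonglongrightarrow> 0"
    using filterlim_compose[OF _ m_lim] by auto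
  have "norm (s n / of_nat n) \<le> F (m n)" if "n \<ge> 1" for n
  proof -
    have r: "root 8 (real n) \<ge> 1" using that by simp
    have r8: "root 8 (real n) ^ 8 = real n" by simp
    have m1: "m n \<ge> 1" using r by (simp add: m_def le_nat_iff)
    have mle: "real (m n) \<le> root 8 (real n)" using r by (simp add: m_def)
    have mgt: "root 8 (real n) < real (m n) + 1" using r unfolding m_def by linarith
    have lo: "real (m n)^8 \<le> real n" using power_mono[OF mle, of 8] r8 by simp
    have hi: "real n \<le> (real (m n) + 1)^8"
      using power_mono[of "root 8 (real n)" "real (m n) + 1" 8] mgt r r8 by simp
    have lon: "m n ^ 8 \<le> n" using lo by (metis of_nat_le_iff of_nat_power)
    have pw: "real i powr (1/16) \<le> sqrt (real (m n) + 1)" if "i \<ge> 1" "i \<le> n" for i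
    proof -
      have "real i powr (1/16) \<le> ((real (m n) + 1)^8) powr (1/16)"
        using hi that by (intro powr_mono2) auto
      also have "\<dots> = ((real (m n) + 1) powr 8) powr (1/16)"
        by (subst powr_numeral) auto
      also have "\<dots> = sqrt (real (m n) + 1)" unfolding powr_powr by (simp add: powr_half_sqrt)
      finally show ?thesis .
    qed
    have split: "s n = s (m n ^ 8) + (\<Sum>i\<in>{m n ^ 8<..n}. z i)"
      unfolding s_def
    proof (subst sum.union_disjoint[symmetric])
      have "{1..m n ^ 8} \<union> {m n ^ 8<..n} = {1..n}" using lon m1 by auto
      then show "sum z {1..n} = sum z ({1..m n ^ 8} \<union> {m n ^ 8<..n})" by simp
    qed auto
    have "norm (\<Sum>i\<in>{m n ^ 8<..n}. z i) \<le> (\<Sum>i\<in>{m n ^ 8<..n}. K * sqrt (real (m n) + 1))"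
    proof (rule sum_norm_le)
      fix i assume i: "i \<in> {m n ^ 8<..n}"
      then have i1: "i \<ge> 1" by auto
      show "norm (z i) \<le> K * sqrt (real (m n) + 1)"
        using z[OF i1] mult_left_mono[OF pw[OF i1] K] i by auto
    qed
    also have "\<dots> = K * (real n - real (m n)^8) * sqrt (real (m n) + 1)"
      using lon by (simp add: of_nat_diff)
    also have "\<dots> \<le> K * ((real (m n) + 1)^8 - real (m n)^8) * sqrt (real (m n) + 1)"
      using hi K by (intro mult_right_mono mult_left_mono) auto
    finally have "norm (s n) \<le> norm (s (m n ^ 8)) + K * ((real (m n) + 1)^8 - real (m n)^8) * sqrt (real (m n) + 1)"
      unfolding split by (intro norm_triangle_le) auto
    then have "norm (s n) / real n \<le> (norm (s (m n ^ 8)) + K * ((real (m n) + 1)^8 - real (m n)^8) * sqrt (real (m n) + 1)) / real n"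
      by (intro divide_right_mono) auto
    also have "\<dots> \<le> (norm (s (m n ^ 8)) + K * ((real (m n) + 1)^8 - real (m n)^8) * sqrt (real (m n) + 1)) / real (m n)^8"
      using lo m1 K that by (intro divide_left_mono add_nonneg_nonneg mult_nonneg_nonneg mult_pos_pos) (auto intro!: power_mono)
    finally show ?thesis by (simp add: F_def norm_divide add_divide_distrib norm_power)
  qed
  then have "\<forall>\<^sub>F n in sequentially. norm (s n / of_nat n) \<le> F (m n)"
    using eventually_sequentially by blast
  then show ?thesis unfolding s_def[symmetric]
    using F_lim by (rule Lim_null_comparison)
qed

context prob_space
begin

text \<open>A second moment form of Borel-Cantelli: the series of squares has finite expectation, so
  it converges almost surely and its terms tend to 0.\<close>

lemma AE_tendsto_zero_of_summable_second_moment: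
  fixes Y :: "nat \<Rightarrow> 'a \<Rightarrow> complex"
  assumes [measurable]: "\<And>m. Y m \<in> borel_measurable M"
    and int: "\<And>m. integrable M (\<lambda>\<omega>. (norm (Y m \<omega>))\<^sup>2)"
    and le: "\<And>m. (\<integral>\<omega>. (norm (Y m \<omega>))\<^sup>2 \<partial>M) \<le> b m" and b: "summable b"
  shows "AE \<omega> in M. (\<lambda>m. Y m \<omega>) \<longlonglongrightarrow> 0"
proof -
  have b0: "0 \<le> b m" for m by (rule order_trans[OF _ le[of m]]) simp
  have "(\<integral>\<^sup>+\<omega>. (\<Sum>m. ennreal ((norm (Y m \<omega>))\<^sup>2)) \<partial>M) = (\<Sum>m. \<integral>\<^sup>+\<omega>. ennreal ((norm (Y m \<omega>))\<^sup>2) \<partial>M)"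
    by (intro nn_integral_suminf) measurable
  also have "\<dots> = (\<Sum>m. ennreal (\<integral>\<omega>. (norm (Y m \<omega>))\<^sup>2 \<partial>M))"
    by (intro suminf_cong nn_integral_eq_integral int) auto
  also have "\<dots> \<le> (\<Sum>m. ennreal (b m))"
    by (intro suminf_le ennreal_leI le summableI)
  also have "\<dots> = ennreal (\<Sum>m. b m)"
    by (intro suminf_ennreal2 b0 b)
  also have "\<dots> < \<infinity>" by simp
  finally have "AE \<omega> in M. (\<Sum>m. ennreal ((norm (Y m \<omega>))\<^sup>2)) \<noteq> \<infinity>"
    by (intro nn_integral_PInf_AE) auto
  then show ?thesis
  proof eventually_elim
    case (elim \<omega>)
    then have "summable (\<lambda>m. (norm (Y m \<omega>))\<^sup>2)"
      by (intro summable_suminf_not_top) auto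
    then have "(\<lambda>m. (norm (Y m \<omega>))\<^sup>2) \<longlonglongrightarrow> 0" by (rule summable_LIMSEQ_zero)
    then have "(\<lambda>m. sqrt ((norm (Y m \<omega>))\<^sup>2)) \<longlonglongrightarrow> sqrt 0" by (intro tendsto_real_sqrt)
    then show ?case by (simp add: tendsto_norm_zero_iff)
  qed
qed

text \<open>The diagonal contributes order \<open>n powr (9/8)\<close> to the second moment of the
  sum, the rest order \<open>n powr (1 + 1/4 + 1/2)\<close>. At \<open>n = m^8\<close>, division by
  \<open>n^2\<close> leaves \<open>m^14 / m^16\<close>, which is summable.\<close>

lemma strong_law_weakly_correlated:
  fixes Z :: "nat \<Rightarrow> 'a \<Rightarrow> complex"
  assumes meas[measurable]: "\<And>i. i \<ge> 1 \<Longrightarrow> Z i \<in> borel_measurable M"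
    and bound: "\<And>i \<omega>. i \<ge> 1 \<Longrightarrow> \<omega> \<in> space M \<Longrightarrow> norm (Z i \<omega>) \<le> K * real i powr (1/16)"
    and corr: "\<And>i j. 1 \<le> i \<Longrightarrow> i < j \<Longrightarrow>
        norm (\<integral>\<omega>. Z i \<omega> * cnj (Z j \<omega>) \<partial>M) \<le> K * real j powr (1/4) / sqrt (real j - real i)"
  shows "AE \<omega> in M. (\<lambda>n. (\<Sum>i\<in>{1..n}. Z i \<omega>) / of_nat n) \<longlonglongrightarrow> 0"
proof -
  obtain \<omega>0 where "\<omega>0 \<in> space M" using not_empty by auto
  then have K: "K \<ge> 0" using bound[of 1 \<omega>0] norm_ge_zero[of "Z 1 \<omega>0"] by (simp del: norm_ge_zero)
  have [measurable]: "cnj \<in> borel_measurable borel"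
    by (intro borel_measurable_continuous_onI continuous_intros)
  have int: "integrable M (\<lambda>\<omega>. Z i \<omega> * cnj (Z j \<omega>))" if "i \<ge> 1" "j \<ge> 1" for i j
  proof (rule integrable_const_bound[where B="(K * real i powr (1/16)) * (K * real j powr (1/16))"])
    show "AE \<omega> in M. norm (Z i \<omega> * cnj (Z j \<omega>)) \<le> (K * real i powr (1/16)) * (K * real j powr (1/16))"
      using bound that K by (intro AE_I2) (auto simp: norm_mult intro!: mult_mono)
  qed (use that in measurable)
  have cov: "norm (\<integral>\<omega>. Z i \<omega> * cnj (Z j \<omega>) \<partial>M) \<le>
      (if i = j then K\<^sup>2 * real n powr (1/8) else K * real n powr (1/4) * (1 / sqrt \<bar>real i - real j\<bar>))"
    if ij: "i \<in> {1..n}" "j \<in> {1..n}" for i j n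
  proof -
    have lt: "norm (\<integral>\<omega>. Z i \<omega> * cnj (Z j \<omega>) \<partial>M) \<le> K * real n powr (1/4) * (1 / sqrt \<bar>real i - real j\<bar>)"
      if "i < j" "1 \<le> i" "j \<le> n" for i j
    proof -
      have "norm (\<integral>\<omega>. Z i \<omega> * cnj (Z j \<omega>) \<partial>M) \<le> K * real j powr (1/4) / sqrt (real j - real i)"
        using corr that by auto
      also have "\<dots> \<le> K * real n powr (1/4) / sqrt (real j - real i)"
        using that K by (intro divide_right_mono mult_left_mono powr_mono2) auto
      finally show ?thesis using that by (simp add: abs_if)
    qed
    consider "i = j" | "i < j" | "j < i" by linarith
    then show ?thesis
    proof cases
      case 1
      have "norm (\<integral>\<omega>. Z i \<omega> * cnj (Z i \<omega>) \<partial>M) \<le> (\<integral>\<omega>. norm (Z i \<omega> * cnj (Z i \<omega>)) \<partial>M)"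
        by simp
      also have "\<dots> \<le> (\<integral>\<omega>. K\<^sup>2 * real n powr (1/8) \<partial>M)"
      proof (rule integral_mono_AE)
        show "integrable M (\<lambda>\<omega>. norm (Z i \<omega> * cnj (Z i \<omega>)))"
          using int[of i i] ij by auto
        have "norm (Z i \<omega> * cnj (Z i \<omega>)) \<le> K\<^sup>2 * real n powr (1/8)" if "\<omega> \<in> space M" for \<omega>
        proof -
          have "norm (Z i \<omega>) \<le> K * real i powr (1/16)" using bound that ij by auto
          also have "\<dots> \<le> K * real n powr (1/16)"
            using ij K by (intro mult_left_mono powr_mono2) auto
          finally have "(norm (Z i \<omega>))\<^sup>2 \<le> (K * real n powr (1/16))\<^sup>2" by (intro power_mono) auto
          also have "\<dots> = K\<^sup>2 * real n powr (1/8)"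
            using ij by (simp add: power_mult_distrib power2_eq_square powr_add[symmetric])
          finally show ?thesis by (simp add: norm_mult power2_eq_square)
        qed
        then show "AE \<omega> in M. norm (Z i \<omega> * cnj (Z i \<omega>)) \<le> K\<^sup>2 * real n powr (1/8)"
          by (intro AE_I2)
      qed auto
      finally show ?thesis using 1 by (simp add: prob_space)
    next
      case 2
      then show ?thesis using lt[of i j] ij by simp
    next
      \<comment> \<open>The correlation hypothesis covers only \<open>i < j\<close>; conjugating the
        integral transposes the pair.\<close>
      case 3
      have "(\<integral>\<omega>. Z i \<omega> * cnj (Z j \<omega>) \<partial>M) = cnj (\<integral>\<omega>. Z j \<omega> * cnj (Z i \<omega>) \<partial>M)"
        using Bochner_Integration.integral_cnj[of M "\<lambda>\<omega>. Z j \<omega> * cnj (Z i \<omega>)"] by (simp add: mult.commute)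
      then show ?thesis using lt[of j i] 3 ij by (simp add: abs_minus_commute)
    qed
  qed
  define S where "S n \<omega> = (\<Sum>i\<in>{1..n}. Z i \<omega>)" for n \<omega>
  have S_meas[measurable]: "S n \<in> borel_measurable M" for n
    unfolding S_def by (intro borel_measurable_sum) auto
  have S_sq: "of_real ((norm (S n \<omega>))\<^sup>2) = (\<Sum>i\<in>{1..n}. \<Sum>j\<in>{1..n}. Z i \<omega> * cnj (Z j \<omega>))" for n \<omega>
    unfolding complex_norm_square S_def cnj_sum sum_product ..
  have S_int': "integrable M (\<lambda>\<omega>. complex_of_real ((norm (S n \<omega>))\<^sup>2))" for n
    unfolding S_sq by (intro Bochner_Integration.integrable_sum int) auto
  have S_int: "integrable M (\<lambda>\<omega>. (norm (S n \<omega>))\<^sup>2)" for n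
    using integrable_Re[OF S_int'[of n]] by simp
  have S_mom: "(\<integral>\<omega>. (norm (S n \<omega>))\<^sup>2 \<partial>M) \<le> (K\<^sup>2 + 4 * K) * real n powr (7/4)" if n: "n \<ge> 1" for n
  proof -
    have "complex_of_real (\<integral>\<omega>. (norm (S n \<omega>))\<^sup>2 \<partial>M) = (\<integral>\<omega>. complex_of_real ((norm (S n \<omega>))\<^sup>2) \<partial>M)"
      by (simp del: of_real_power)
    also have "\<dots> = (\<Sum>i\<in>{1..n}. \<Sum>j\<in>{1..n}. (\<integral>\<omega>. Z i \<omega> * cnj (Z j \<omega>) \<partial>M))"
      unfolding S_sq using int
      by (subst Bochner_Integration.integral_sum, force)
        (intro sum.cong refl Bochner_Integration.integral_sum, auto)
    finally have eq: "complex_of_real (\<integral>\<omega>. (norm (S n \<omega>))\<^sup>2 \<partial>M) =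
        (\<Sum>i\<in>{1..n}. \<Sum>j\<in>{1..n}. (\<integral>\<omega>. Z i \<omega> * cnj (Z j \<omega>) \<partial>M))" .
    have "(\<integral>\<omega>. (norm (S n \<omega>))\<^sup>2 \<partial>M) \<le> norm (complex_of_real (\<integral>\<omega>. (norm (S n \<omega>))\<^sup>2 \<partial>M))"
      by simp
    also have "\<dots> \<le> (\<Sum>i\<in>{1..n}. \<Sum>j\<in>{1..n}. norm (\<integral>\<omega>. Z i \<omega> * cnj (Z j \<omega>) \<partial>M))"
      unfolding eq by (intro sum_norm_le) auto
    also have "\<dots> \<le> (\<Sum>i\<in>{1..n}. K\<^sup>2 * real n powr (1/8) + K * real n powr (1/4) * (4 * sqrt (real n)))"
    proof (rule sum_mono)
      fix i assume i: "i \<in> {1..n}"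
      have "(\<Sum>j\<in>{1..n}. norm (\<integral>\<omega>. Z i \<omega> * cnj (Z j \<omega>) \<partial>M)) =
          norm (\<integral>\<omega>. Z i \<omega> * cnj (Z i \<omega>) \<partial>M) + (\<Sum>j\<in>{1..n} - {i}. norm (\<integral>\<omega>. Z i \<omega> * cnj (Z j \<omega>) \<partial>M))"
        using i by (intro sum.remove) auto
      also have "\<dots> \<le> K\<^sup>2 * real n powr (1/8) + (\<Sum>j\<in>{1..n} - {i}. K * real n powr (1/4) * (1 / sqrt \<bar>real i - real j\<bar>))"
      proof (intro add_mono sum_mono)
        show "norm (\<integral>\<omega>. Z i \<omega> * cnj (Z i \<omega>) \<partial>M) \<le> K\<^sup>2 * real n powr (1/8)"
          using cov[OF i i] by simp
        show "norm (\<integral>\<omega>. Z i \<omega> * cnj (Z j \<omega>) \<partial>M) \<le> K * real n powr (1/4) * (1 / sqrt \<bar>real i - real j\<bar>)"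
          if "j \<in> {1..n} - {i}" for j
          using cov[OF i, of j] that by auto
      qed
      also have "(\<Sum>j\<in>{1..n} - {i}. K * real n powr (1/4) * (1 / sqrt \<bar>real i - real j\<bar>))
          = K * real n powr (1/4) * (\<Sum>j\<in>{1..n} - {i}. 1 / sqrt \<bar>real i - real j\<bar>)"
        by (simp only: sum_distrib_left)
      also have "\<dots> \<le> K * real n powr (1/4) * (4 * sqrt (real n))"
        using K by (intro mult_left_mono sum_inverse_sqrt_dist_le[OF i]) auto
      finally show "(\<Sum>j\<in>{1..n}. norm (\<integral>\<omega>. Z i \<omega> * cnj (Z j \<omega>) \<partial>M)) \<le>
          K\<^sup>2 * real n powr (1/8) + K * real n powr (1/4) * (4 * sqrt (real n))" by simp
    qed
    also have "\<dots> = K\<^sup>2 * (real n * real n powr (1/8)) + 4 * K * (real n * real n powr (1/4) * sqrt (real n))"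
      by (simp add: algebra_simps)
    also have "real n * real n powr (1/8) = real n powr (9/8)"
      using powr_add[of "real n" 1 "1/8"] n by simp
    also have "real n * real n powr (1/4) * sqrt (real n) = real n powr (7/4)"
      using powr_add[of "real n" 1 "1/4"] powr_add[of "real n" "5/4" "1/2"] n
      by (simp add: powr_half_sqrt)
    also have "K\<^sup>2 * real n powr (9/8) + 4 * K * real n powr (7/4) \<le> (K\<^sup>2 + 4 * K) * real n powr (7/4)"
      unfolding distrib_right using n by (intro add_right_mono mult_left_mono powr_mono) auto
    finally show ?thesis .
  qed
  have "AE \<omega> in M. (\<lambda>m. S (m^8) \<omega> / of_nat (m^8)) \<longlonglongrightarrow> 0"
  proof (rule AE_tendsto_zero_of_summable_second_moment)
    have sq: "(norm (S (m^8) \<omega> / of_nat (m^8)))\<^sup>2 = (norm (S (m^8) \<omega>))\<^sup>2 / real m ^ 16" for m \<omega>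
      by (simp add: norm_divide norm_power power_divide power_mult[symmetric])
    show "integrable M (\<lambda>\<omega>. (norm (S (m^8) \<omega> / of_nat (m^8)))\<^sup>2)" for m
      unfolding sq using S_int by auto
    show "(\<integral>\<omega>. (norm (S (m^8) \<omega> / of_nat (m^8)))\<^sup>2 \<partial>M) \<le> (K\<^sup>2 + 4 * K) * (1 / real m ^ 2)" for m
    proof (cases "m = 0")
      case False
      have "real (m^8) powr (7/4) = (real m powr 8) powr (7/4)" using False by (simp add: powr_numeral)
      also have "\<dots> = real m powr 14" unfolding powr_powr by simp
      also have "\<dots> = real m ^ 14" using False by (simp add: powr_numeral)
      finally have p: "real (m^8) powr (7/4) = real m ^ 14" .
      have "(\<integral>\<omega>. (norm (S (m^8) \<omega> / of_nat (m^8)))\<^sup>2 \<partial>M) = (\<integral>\<omega>. (norm (S (m^8) \<omega>))\<^sup>2 \<partial>M) / real m ^ 16"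
        unfolding sq by simp
      also have "\<dots> \<le> ((K\<^sup>2 + 4 * K) * real m ^ 14) / real m ^ 16"
        using S_mom[of "m^8"] False p by (intro divide_right_mono) auto
      also have "\<dots> = (K\<^sup>2 + 4 * K) * (1 / real m ^ 2)"
        using False by (simp add: field_simps flip: power_add)
      finally show ?thesis .
    qed (simp add: sq)
    show "summable (\<lambda>m. (K\<^sup>2 + 4 * K) * (1 / real m ^ 2))"
      using inverse_power_summable[of 2, where 'a=real] by (intro summable_mult) (simp add: field_simps)
  qed measurable
  moreover have "AE \<omega> in M. \<omega> \<in> space M" by simp
  ultimately show ?thesis
  proof eventually_elim
    case (elim \<omega>)
    show ?case
      by (rule average_tendsto_zero_from_subsequence[where K=K])
        (use bound elim in \<open>auto simp: S_def\<close>)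
  qed
qed

end

section \<open>Characters along the walk\<close>

text \<open>Since \<open>ty\<close> is an arbitrary sequence, the steps are independent but not
  identically distributed; finiteness of \<open>A\<close> supplies constants valid at every
  step.\<close>

locale random_walk = prob_space M for M :: "'w measure" +
  fixes k :: nat and A :: "(nat \<Rightarrow> real) set"
    and ty :: "nat \<Rightarrow> nat \<Rightarrow> real" and W :: "nat \<Rightarrow> 'w \<Rightarrow> nat"
  assumes k_ge_2: "k \<ge> 2"
    and finite_A: "finite A"
    and A_bounds: "\<alpha> \<in> A \<Longrightarrow> j < k \<Longrightarrow> 0 < \<alpha> j \<and> \<alpha> j < 1"
    and A_sum: "\<alpha> \<in> A \<Longrightarrow> (\<Sum>j<k. \<alpha> j) = 1"
    and ty_in_A: "i \<ge> 1 \<Longrightarrow> ty i \<in> A"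
    and W_measurable: "i \<ge> 1 \<Longrightarrow> W i \<in> measurable M (count_space UNIV)"
    and W_less: "i \<ge> 1 \<Longrightarrow> \<omega> \<in> space M \<Longrightarrow> W i \<omega> < k"
    and W_indep: "indep_vars (\<lambda>_. count_space UNIV) W {1..}"
    and W_distr: "i \<ge> 1 \<Longrightarrow> j < k \<Longrightarrow> measure M {\<omega> \<in> space M. W i \<omega> = j} = ty i j"
begin

definition step_mean :: "(nat \<Rightarrow> real) \<Rightarrow> (nat \<Rightarrow> complex) \<Rightarrow> complex" where
  "step_mean \<alpha> g = (\<Sum>l<k. of_real (\<alpha> l) * g l)"

text \<open>If \<open>g l\<close> is the value of a character at the \<open>l\<close>-th basis
  vector, this is its value at the position after \<open>i\<close> steps. Writing it as a product
  over steps makes independence directly applicable.\<close>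

definition phase :: "(nat \<Rightarrow> complex) \<Rightarrow> nat \<Rightarrow> 'w \<Rightarrow> complex" where
  "phase g i \<omega> = (\<Prod>t\<in>{1..i}. g (W t \<omega>))"

lemma has_bochner_integral_step:
  assumes "t \<ge> 1"
  shows "has_bochner_integral M (\<lambda>\<omega>. g (W t \<omega>)) (step_mean (ty t) g)"
proof -
  define E where "E l = {\<omega> \<in> space M. W t \<omega> = l}" for l
  note W_measurable[OF assms, measurable]
  have E: "E l \<in> sets M" for l unfolding E_def by measurable
  have "has_bochner_integral M (\<lambda>\<omega>. \<Sum>l<k. indicator (E l) \<omega> *\<^sub>R g l) (\<Sum>l<k. measure M (E l) *\<^sub>R g l)"
    by (intro has_bochner_integral_sum has_bochner_integral_scaleR_left has_bochner_integral_real_indicator E)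
       (simp_all add: emeasure_eq_measure)
  also have "(\<Sum>l<k. measure M (E l) *\<^sub>R g l) = step_mean (ty t) g"
    unfolding step_mean_def E_def using assms W_distr by (intro sum.cong) (auto simp: scaleR_conv_of_real)
  finally have *: "has_bochner_integral M (\<lambda>\<omega>. \<Sum>l<k. indicator (E l) \<omega> *\<^sub>R g l) (step_mean (ty t) g)" .
  have "(\<Sum>l<k. indicator (E l) \<omega> *\<^sub>R g l) = g (W t \<omega>)" if "\<omega> \<in> space M" for \<omega>
  proof -
    have "(\<Sum>l<k. indicator (E l) \<omega> *\<^sub>R g l) = (\<Sum>l<k. if l = W t \<omega> then g l else 0)"
      using that by (intro sum.cong) (auto simp: E_def indicator_def)
    also have "\<dots> = g (W t \<omega>)" using W_less[OF assms that] by (simp add: sum.delta)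
    finally show ?thesis .
  qed
  then show ?thesis
    using * by (subst has_bochner_integral_cong[of M M, OF refl _ refl, symmetric]) auto
qed

lemma expectation_prod:
  fixes f :: "nat \<Rightarrow> nat \<Rightarrow> complex"
  assumes "finite I" "I \<subseteq> {1..}"
  shows "(\<integral>\<omega>. (\<Prod>t\<in>I. f t (W t \<omega>)) \<partial>M) = (\<Prod>t\<in>I. step_mean (ty t) (f t))"
proof -
  have ind: "indep_vars (\<lambda>_. borel) (\<lambda>t \<omega>. f t (W t \<omega>)) I"
    by (rule indep_vars_compose2[OF indep_vars_subset[OF W_indep assms(2)]]) auto
  have int: "integrable M (\<lambda>\<omega>. f t (W t \<omega>))"
    and eq: "(\<integral>\<omega>. f t (W t \<omega>) \<partial>M) = step_mean (ty t) (f t)" if "t \<in> I" for t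
    using has_bochner_integral_step[of t "f t"] assms(2) that
    by (auto simp: has_bochner_integral_iff)
  show ?thesis
    using indep_vars_lebesgue_integral[OF assms(1) ind int] eq by simp
qed

lemma norm_step_mean_le_1:
  assumes "\<alpha> \<in> A" "\<And>l. norm (g l) \<le> 1"
  shows "norm (step_mean \<alpha> g) \<le> 1"
proof -
  have "norm (step_mean \<alpha> g) \<le> (\<Sum>l<k. \<alpha> l)"
    unfolding step_mean_def
  proof (rule sum_norm_le)
    fix l assume "l \<in> {..<k}"
    then have "\<alpha> l > 0" using A_bounds assms by auto
    then show "norm (of_real (\<alpha> l) * g l) \<le> \<alpha> l"
      using assms(2)[of l] by (simp add: norm_mult mult_left_le)
  qed
  then show ?thesis using A_sum assms by simp
qed

text \<open>Factors outside \<open>J\<close> have mean of modulus at most 1 and are discarded, so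
  decay can be read off from the steps where the integrand is understood.\<close>

lemma norm_expectation_prod_le:
  fixes f :: "nat \<Rightarrow> nat \<Rightarrow> complex"
  assumes "finite I" "I \<subseteq> {1..}" "J \<subseteq> I" "\<And>t l. norm (f t l) \<le> 1"
  shows "norm (\<integral>\<omega>. (\<Prod>t\<in>I. f t (W t \<omega>)) \<partial>M) \<le> (\<Prod>t\<in>J. norm (step_mean (ty t) (f t)))"
proof -
  have "(\<Prod>t\<in>I. norm (step_mean (ty t) (f t))) \<le> (\<Prod>t\<in>J. norm (step_mean (ty t) (f t)))"
  proof -
    have "(\<Prod>t\<in>I. norm (step_mean (ty t) (f t)))
        = (\<Prod>t\<in>I-J. norm (step_mean (ty t) (f t))) * (\<Prod>t\<in>J. norm (step_mean (ty t) (f t)))"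
      using assms by (intro prod.subset_diff) auto
    also have "\<dots> \<le> 1 * (\<Prod>t\<in>J. norm (step_mean (ty t) (f t)))"
    proof (intro mult_right_mono prod_le_1 conjI prod_nonneg ballI)
      show "norm (step_mean (ty t) (f t)) \<le> 1" if "t \<in> I - J" for t
        using that assms by (intro norm_step_mean_le_1 ty_in_A) auto
    qed auto
    finally show ?thesis by simp
  qed
  then show ?thesis using expectation_prod[OF assms(1,2), of f] by (simp add: prod_norm)
qed

lemma step_mean_cnj: "step_mean \<alpha> (\<lambda>l. cnj (g l)) = cnj (step_mean \<alpha> g)"
  unfolding step_mean_def by simp

text \<open>Steps up to \<open>i\<close> carry \<open>g * cnj g'\<close>, where cancellation may
  leave no decay; steps \<open>i+1\<close> and \<open>j+1\<close> carry the extra factors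
  \<open>h\<close> and \<open>h'\<close>. Only steps \<open>i+2\<close> to \<open>j\<close> carry
  \<open>cnj g'\<close> alone, and only these are kept.\<close>

lemma phase_correlation_le:
  fixes g g' h h' :: "nat \<Rightarrow> complex"
  assumes g: "\<And>l. norm (g l) = 1" and g': "\<And>l. norm (g' l) = 1"
    and h: "\<And>l. norm (h l) = 1" and h': "\<And>l. norm (h' l) = 1" and ij: "i < j"
  shows "norm (\<integral>\<omega>. (phase g i \<omega> * h (W (i+1) \<omega>)) * cnj (phase g' j \<omega> * h' (W (j+1) \<omega>)) \<partial>M)
      \<le> (\<Prod>t\<in>{i+2..j}. norm (step_mean (ty t) g'))"
proof -
  define f where "f t l = (if t \<le> i then g l else 1) * (if t = i+1 then h l else 1)
     * ((if t \<le> j then cnj (g' l) else 1) * (if t = j+1 then cnj (h' l) else 1))" for t l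
  have r: "(\<Prod>t\<in>{1..j+1}. if t \<le> m then u t else 1) = (\<Prod>t\<in>{1..m}. u t)"
    if "m \<le> j" for m :: nat and u :: "nat \<Rightarrow> complex"
    using that by (intro prod.mono_neutral_cong_right) auto
  have s: "(\<Prod>t\<in>{1..j+1}. if t = m then u t else 1) = u m"
    if "m \<in> {1..j+1}" for m :: nat and u :: "nat \<Rightarrow> complex"
    using prod.delta'[of "{1..j+1}" m u] that prod.delta[of "{1..j+1}" m u] by simp
  have eq: "(phase g i \<omega> * h (W (i+1) \<omega>)) * cnj (phase g' j \<omega> * h' (W (j+1) \<omega>)) = (\<Prod>t\<in>{1..j+1}. f t (W t \<omega>))" for \<omega>
  proof -
    have "(\<Prod>t\<in>{1..j+1}. f t (W t \<omega>)) =
       (\<Prod>t\<in>{1..j+1}. if t \<le> i then g (W t \<omega>) else 1) * (\<Prod>t\<in>{1..j+1}. if t = i+1 then h (W t \<omega>) else 1)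
       * ((\<Prod>t\<in>{1..j+1}. if t \<le> j then cnj (g' (W t \<omega>)) else 1)
         * (\<Prod>t\<in>{1..j+1}. if t = j+1 then cnj (h' (W t \<omega>)) else 1))"
      unfolding f_def prod.distrib ..
    also have "\<dots> = (\<Prod>t\<in>{1..i}. g (W t \<omega>)) * h (W (i+1) \<omega>)
       * ((\<Prod>t\<in>{1..j}. cnj (g' (W t \<omega>))) * cnj (h' (W (j+1) \<omega>)))"
      using ij r[of i "\<lambda>t. g (W t \<omega>)"] r[of j "\<lambda>t. cnj (g' (W t \<omega>))"]
        s[of "i+1" "\<lambda>t. h (W t \<omega>)"] s[of "j+1" "\<lambda>t. cnj (h' (W t \<omega>))"]
      by (simp only: atLeastAtMost_iff) simp
    finally show ?thesis by (simp add: phase_def)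
  qed
  have "norm (\<integral>\<omega>. (\<Prod>t\<in>{1..j+1}. f t (W t \<omega>)) \<partial>M) \<le> (\<Prod>t\<in>{i+2..j}. norm (step_mean (ty t) (f t)))"
    by (rule norm_expectation_prod_le) (auto simp: f_def norm_mult g g' h h')
  also have "\<dots> = (\<Prod>t\<in>{i+2..j}. norm (step_mean (ty t) g'))"
  proof (rule prod.cong)
    fix t assume "t \<in> {i+2..j}"
    then have "f t = (\<lambda>l. cnj (g' l))" by (auto simp: f_def fun_eq_iff)
    then show "norm (step_mean (ty t) (f t)) = norm (step_mean (ty t) g')" by (simp add: step_mean_cnj)
  qed simp
  finally show ?thesis unfolding eq .
qed

lemma norm_phase: "(\<And>l. norm (g l) = 1) \<Longrightarrow> norm (phase g i \<omega>) = 1"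
  by (simp add: phase_def prod_norm[symmetric])

lemma phase_measurable: "phase g i \<in> borel_measurable M"
  unfolding phase_def[abs_def]
proof (intro borel_measurable_prod)
  fix t assume "t \<in> {1..i}"
  then have "W t \<in> measurable M (count_space UNIV)" by (intro W_measurable) auto
  then show "(\<lambda>\<omega>. g (W t \<omega>)) \<in> borel_measurable M" by (rule measurable_compose) auto
qed

text \<open>Strict convexity of the disc: equality in the triangle inequality forces
  \<open>g l\<close> and \<open>g l'\<close>, which are unit vectors with positive weights, to
  coincide.\<close>

lemma norm_step_mean_less_1:
  assumes \<alpha>: "\<alpha> \<in> A" and g: "\<And>l. norm (g l) = 1" and l: "l < k" "l' < k" "g l \<noteq> g l'"
  shows "norm (step_mean \<alpha> g) < 1"
proof -
  have pos: "\<alpha> l > 0" "\<alpha> l' > 0" using A_bounds \<alpha> l by auto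
  have ne: "l \<noteq> l'" using l by auto
  have "norm (of_real (\<alpha> l) * g l + of_real (\<alpha> l') * g l') \<noteq> \<alpha> l + \<alpha> l'"
  proof
    assume "norm (of_real (\<alpha> l) * g l + of_real (\<alpha> l') * g l') = \<alpha> l + \<alpha> l'"
    then have "norm (of_real (\<alpha> l) * g l + of_real (\<alpha> l') * g l')
       = norm (of_real (\<alpha> l) * g l) + norm (of_real (\<alpha> l') * g l')"
      using pos by (simp add: norm_mult g)
    then have "norm (of_real (\<alpha> l) * g l) *\<^sub>R (of_real (\<alpha> l') * g l')
       = norm (of_real (\<alpha> l') * g l') *\<^sub>R (of_real (\<alpha> l) * g l)"
      by (subst (asm) norm_triangle_eq)
    then show False using pos l by (simp add: norm_mult g scaleR_conv_of_real)
  qed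
  moreover have "norm (of_real (\<alpha> l) * g l + of_real (\<alpha> l') * g l') \<le> \<alpha> l + \<alpha> l'"
    using pos by (intro norm_triangle_le) (simp add: norm_mult g)
  ultimately have two: "norm (of_real (\<alpha> l) * g l + of_real (\<alpha> l') * g l') < \<alpha> l + \<alpha> l'" by simp
  have rest: "norm (\<Sum>m\<in>{..<k}-{l,l'}. of_real (\<alpha> m) * g m) \<le> (\<Sum>m\<in>{..<k}-{l,l'}. \<alpha> m)"
  proof (rule sum_norm_le)
    fix m assume "m \<in> {..<k} - {l,l'}"
    then have "\<alpha> m > 0" using A_bounds \<alpha> by auto
    then show "norm (of_real (\<alpha> m) * g m) \<le> \<alpha> m" by (simp add: norm_mult g)
  qed
  have split: "(\<Sum>m<k. u m) = (\<Sum>m\<in>{..<k}-{l,l'}. u m) + (u l + u l')" for u :: "nat \<Rightarrow> 'b::comm_monoid_add"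
    using l ne sum.subset_diff[of "{l,l'}" "{..<k}" u] by simp
  have "norm (step_mean \<alpha> g) \<le> norm (\<Sum>m\<in>{..<k}-{l,l'}. of_real (\<alpha> m) * g m)
      + norm (of_real (\<alpha> l) * g l + of_real (\<alpha> l') * g l')"
    unfolding step_mean_def split by (rule norm_triangle_ineq)
  also have "\<dots> < (\<Sum>m\<in>{..<k}-{l,l'}. \<alpha> m) + (\<alpha> l + \<alpha> l')"
    using rest two by linarith
  also have "\<dots> = 1" using split[of \<alpha>] A_sum[OF \<alpha>] by simp
  finally show ?thesis .
qed

lemma uniform_contraction:
  assumes "\<And>l. norm (g l) = 1" "l < k" "l' < k" "g l \<noteq> g l'"
  shows "\<exists>\<rho>. 0 < \<rho> \<and> \<rho> < 1 \<and> (\<forall>\<alpha>\<in>A. norm (step_mean \<alpha> g) \<le> \<rho>)"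
proof -
  \<comment> \<open>The element \<open>1/2\<close> keeps the maximum positive even if every step
    mean vanishes, as for weights \<open>1/2\<close>, \<open>1/2\<close> and values 1, -1.\<close>
  define R where "R = insert (1/2) ((\<lambda>\<alpha>. norm (step_mean \<alpha> g)) ` A)"
  have R: "finite R" "R \<noteq> {}" using finite_A by (auto simp: R_def)
  have "Max R < 1" using R norm_step_mean_less_1 assms by (subst Max_less_iff) (auto simp: R_def)
  moreover have "1/2 \<in> R" "\<forall>\<alpha>\<in>A. norm (step_mean \<alpha> g) \<in> R" by (auto simp: R_def)
  then have "1/2 \<le> Max R" "\<forall>\<alpha>\<in>A. norm (step_mean \<alpha> g) \<le> Max R"
    using R Max_ge by blast+
  ultimately show ?thesis by (intro exI[of _ "Max R"]) auto
qed

text \<open>The factor \<open>h\<close> is the extra step that expresses a character at time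
  \<open>i + 1\<close> through one at time \<open>i\<close>; the weight \<open>c\<close> makes room
  for residue classes and local densities.\<close>

lemma average_nonconstant_phase:
  fixes c :: "nat \<Rightarrow> complex"
  assumes g: "\<And>l. norm (g l) = 1" and h: "\<And>l. norm (h l) = 1"
    and l: "l < k" "l' < k" "g l \<noteq> g l'" and c: "\<And>i. norm (c i) \<le> 1"
  shows "AE \<omega> in M. (\<lambda>n. (\<Sum>i\<in>{1..n}. c i * phase g i \<omega> * h (W (i+1) \<omega>)) / of_nat n) \<longlonglongrightarrow> 0"
proof -
  obtain \<rho> where \<rho>: "0 < \<rho>" "\<rho> < 1" "\<And>\<alpha>. \<alpha> \<in> A \<Longrightarrow> norm (step_mean \<alpha> g) \<le> \<rho>"
    using uniform_contraction[OF g l] by blast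
  \<comment> \<open>Geometric decay is weakened to the rate in the strong law; with
    \<open>n = j - i - 1\<close> the root is exactly \<open>sqrt (j - i)\<close>.\<close>
  have "(\<lambda>n. \<rho> ^ n * sqrt (real n + 1)) \<longlonglongrightarrow> 0"
    using \<rho> by real_asymp
  then have "Bseq (\<lambda>n. \<rho> ^ n * sqrt (real n + 1))"
    using convergent_imp_Bseq convergentI by blast
  then obtain K where K: "K > 0" "\<And>n. norm (\<rho> ^ n * sqrt (real n + 1)) \<le> K"
    unfolding Bseq_def by blast
  show ?thesis
  proof (rule strong_law_weakly_correlated[where K="max 1 K"])
    show "(\<lambda>\<omega>. c i * phase g i \<omega> * h (W (i+1) \<omega>)) \<in> borel_measurable M" if "i \<ge> 1" for i
    proof -
      have "(\<lambda>\<omega>. h (W (i+1) \<omega>)) \<in> borel_measurable M"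
        by (rule measurable_compose[OF W_measurable]) auto
      then show ?thesis using phase_measurable by (intro borel_measurable_times) auto
    qed
    show "norm (c i * phase g i \<omega> * h (W (i+1) \<omega>)) \<le> max 1 K * real i powr (1/16)" if "i \<ge> 1" for i \<omega>
    proof -
      have "norm (c i * phase g i \<omega> * h (W (i+1) \<omega>)) \<le> 1 * 1"
        using c[of i] by (simp add: norm_mult norm_phase[OF g] h)
      also have "\<dots> \<le> max 1 K * real i powr (1/16)"
        using that by (intro mult_mono ge_one_powr_ge_zero) auto
      finally show ?thesis .
    qed
    fix i j :: nat assume ij: "1 \<le> i" "i < j"
    define I where "I = (\<integral>\<omega>. (phase g i \<omega> * h (W (i+1) \<omega>)) * cnj (phase g j \<omega> * h (W (j+1) \<omega>)) \<partial>M)"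
    have eq: "(\<integral>\<omega>. (c i * phase g i \<omega> * h (W (i+1) \<omega>)) * cnj (c j * phase g j \<omega> * h (W (j+1) \<omega>)) \<partial>M)
       = (c i * cnj (c j)) * I"
      unfolding I_def Bochner_Integration.integral_mult_right_zero[symmetric]
      by (intro Bochner_Integration.integral_cong) (simp_all add: mult_ac)
    have "norm (c i * cnj (c j)) \<le> 1"
      using mult_mono[OF c[of i] c[of j]] by (simp add: norm_mult)
    then have "norm ((c i * cnj (c j)) * I) \<le> norm I"
      unfolding norm_mult[of _ I] by (rule mult_left_le_one_le[rotated 2]) auto
    also have "\<dots> \<le> (\<Prod>t\<in>{i+2..j}. norm (step_mean (ty t) g))"
      unfolding I_def by (rule phase_correlation_le[OF g g h h ij(2)])
    also have "\<dots> \<le> (\<Prod>t\<in>{i+2..j}. \<rho>)"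
      using ty_in_A \<rho> by (intro prod_mono) auto
    also have "\<dots> = \<rho> ^ (j - i - 1)" by (simp add: Suc_diff_le)
    also have "\<dots> \<le> K / sqrt (real j - real i)"
    proof -
      have e: "real (j - i - 1) + 1 = real j - real i" using ij by auto
      show ?thesis using K(2)[of "j - i - 1"] \<rho>(1) ij unfolding e by (simp add: pos_le_divide_eq abs_mult)
    qed
    also have "\<dots> \<le> max 1 K * real j powr (1/4) / sqrt (real j - real i)"
    proof (rule divide_right_mono)
      have "K * 1 \<le> max 1 K * real j powr (1/4)"
        using ij K(1) by (intro mult_mono ge_one_powr_ge_zero) auto
      then show "K \<le> max 1 K * real j powr (1/4)" by simp
    qed (use ij in auto)
    finally show "norm (\<integral>\<omega>. (c i * phase g i \<omega> * h (W (i+1) \<omega>)) * cnj (c j * phase g j \<omega> * h (W (j+1) \<omega>)) \<partial>M)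
       \<le> max 1 K * real j powr (1/4) / sqrt (real j - real i)" unfolding eq .
  qed
qed

end

section \<open>Sieving by finitely many primes\<close>

definition averages_to :: "(nat \<Rightarrow> complex) \<Rightarrow> complex \<Rightarrow> bool" where
  "averages_to f L \<longleftrightarrow> (\<lambda>n. (\<Sum>i\<in>{1..n}. f i) / of_nat n) \<longlonglongrightarrow> L"

lemma averages_to_add: "averages_to f a \<Longrightarrow> averages_to g b \<Longrightarrow> averages_to (\<lambda>i. f i + g i) (a + b)"
  unfolding averages_to_def by (simp only: sum.distrib add_divide_distrib tendsto_add)

lemma averages_to_diff: "averages_to f a \<Longrightarrow> averages_to g b \<Longrightarrow> averages_to (\<lambda>i. f i - g i) (a - b)"
  unfolding averages_to_def by (simp only: sum_subtractf diff_divide_distrib tendsto_diff)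

lemma averages_to_cmult: "averages_to f a \<Longrightarrow> averages_to (\<lambda>i. c * f i) (c * a)"
  unfolding averages_to_def sum_distrib_left[symmetric] times_divide_eq_right[symmetric]
  by (intro tendsto_mult tendsto_const)

lemma averages_to_sum:
  "(\<And>x. x \<in> X \<Longrightarrow> averages_to (f x) (a x)) \<Longrightarrow> averages_to (\<lambda>i. \<Sum>x\<in>X. f x i) (\<Sum>x\<in>X. a x)"
proof (induction X rule: infinite_finite_induct)
  case (insert x X)
  then show ?case using averages_to_add[of "f x" "a x"] by simp
qed (simp_all add: averages_to_def)

definition class_ind :: "nat \<Rightarrow> nat \<Rightarrow> nat \<Rightarrow> complex" where
  "class_ind a m i = (if i mod m = a mod m then 1 else 0)"

lemma averages_to_class_ind:
  assumes "m \<ge> 1"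
  shows "averages_to (class_ind a m) (1 / of_nat m)"
proof -
  \<comment> \<open>Shifting by \<open>s\<close> moves the class of \<open>a\<close> to the class of
    0, so the count is a difference of quotients. If \<open>m\<close> divides \<open>a\<close>, then
    \<open>s = m\<close> and the correction \<open>s div m\<close> is 1 rather than 0.\<close>
  define s where "s = m - a mod m"
  have s: "s > 0" "s \<le> m" using assms by (auto simp: s_def)
  have rm: "i mod m = a mod m \<longleftrightarrow> (i + s) mod m = 0" for i
  proof -
    have "(i + s) mod m = 0 \<longleftrightarrow> [i + s = a mod m + s] (mod m)"
      using assms by (simp add: s_def cong_def)
    also have "\<dots> \<longleftrightarrow> [i = a mod m] (mod m)" by (rule cong_add_rcancel_nat)
    also have "\<dots> \<longleftrightarrow> i mod m = a mod m" by (simp add: cong_def)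
    finally show ?thesis by simp
  qed
  have eq: "(\<Sum>i\<in>{1..n}. class_ind a m i) = of_nat ((n + s) div m) - of_nat (s div m)" for n
  proof (induction n)
    case (Suc n)
    then show ?case using rm[of "Suc n"]
      by (auto simp: class_ind_def div_Suc)
  qed simp
  have "(\<lambda>n. real_of_int \<lfloor>(real n + real s) / real m\<rfloor> / real n) \<longlonglongrightarrow> 1 / real m"
    using assms by real_asymp (simp add: field_simps)
  moreover have "real_of_int \<lfloor>(real n + real s) / real m\<rfloor> = real ((n + s) div m)" for n
    using floor_divide_of_nat_eq[of "n + s" m, where 'a=real] by simp
  ultimately have "(\<lambda>n. real ((n + s) div m) / real n - real (s div m) / real n) \<longlonglongrightarrow> 1 / real m - 0"
    by (intro tendsto_diff) (auto intro: lim_const_over_n)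
  then have "(\<lambda>n. complex_of_real (real ((n + s) div m) / real n - real (s div m) / real n)) \<longlonglongrightarrow> complex_of_real (1 / real m)"
    by (intro tendsto_of_real) simp
  then show ?thesis
    unfolding averages_to_def eq by (simp add: diff_divide_distrib)
qed

section \<open>Roots of unity and characters modulo \<open>p\<close>\<close>

definition root_pow :: "nat \<Rightarrow> nat \<Rightarrow> complex" where
  "root_pow p j = exp (2 * of_real pi * \<i> * of_nat j / of_nat p)"

lemma root_pow_power: "root_pow p a ^ n = root_pow p (a * n)"
  unfolding root_pow_def by (simp add: exp_of_nat_mult[symmetric] mult_ac)

lemma norm_root_pow [simp]: "norm (root_pow p a) = 1"
  unfolding root_pow_def by (simp add: Re_divide_of_nat)

lemma root_pow_eq_iff: "p \<ge> 1 \<Longrightarrow> root_pow p a = root_pow p b \<longleftrightarrow> [a = b] (mod p)"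
  unfolding root_pow_def cong_def by (rule complex_root_unity_eq)

lemma root_pow_eq_1_iff: "p \<ge> 1 \<Longrightarrow> root_pow p a = 1 \<longleftrightarrow> p dvd a"
  unfolding root_pow_def by (rule complex_root_unity_eq_1)

lemma sum_root_pow:
  assumes "p \<ge> 1"
  shows "(\<Sum>c<p. root_pow p (c * n)) = (if p dvd n then of_nat p else 0)"
proof -
  have eq: "(\<Sum>c<p. root_pow p (c * n)) = (\<Sum>c<p. root_pow p n ^ c)"
    by (simp add: root_pow_power mult.commute)
  have "root_pow p n ^ p = 1" using assms by (simp add: root_pow_power root_pow_eq_1_iff)
  then show ?thesis
    unfolding eq using assms by (auto simp: root_pow_eq_1_iff[symmetric] sum_gp_strict)
qed

text \<open>Exponent vectors of characters of \<open>(Z/p)^k\<close>, extensional so that each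
  character occurs once. The excluded constant vectors see only the coordinate sum.\<close>

definition nonconst_fun :: "nat \<Rightarrow> nat \<Rightarrow> (nat \<Rightarrow> nat) set" where
  "nonconst_fun k p = {\<xi> \<in> PiE {..<k} (\<lambda>_. {..<p}). \<exists>l<k. \<exists>l'<k. \<xi> l \<noteq> \<xi> l'}"

lemma finite_nonconst_fun: "finite (nonconst_fun k p)"
  unfolding nonconst_fun_def by (auto intro!: finite_PiE)

lemma sum_PiE_const_nonconst:
  fixes F :: "(nat \<Rightarrow> nat) \<Rightarrow> complex"
  assumes k: "k \<ge> 1"
  shows "sum F (PiE {..<k} (\<lambda>_. {..<p})) = (\<Sum>c<p. F (restrict (\<lambda>_. c) {..<k})) + sum F (nonconst_fun k p)"
proof -
  define C where "C = (\<lambda>c. restrict (\<lambda>_. c) {..<k}) ` {..<p}"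
  have inj: "inj_on (\<lambda>c. restrict (\<lambda>_. c) {..<k}) {..<p}"
  proof (rule inj_onI)
    fix c d assume "restrict (\<lambda>_. c) {..<k} = restrict (\<lambda>_. d) {..<k}"
    from fun_cong[OF this, of 0] show "c = d" using k by simp
  qed
  have C_sum: "sum F C = (\<Sum>c<p. F (restrict (\<lambda>_. c) {..<k}))"
    unfolding C_def sum.reindex[OF inj] comp_def ..
  have eq: "PiE {..<k} (\<lambda>_. {..<p}) = C \<union> nonconst_fun k p"
  proof (rule equalityI; rule subsetI)
    fix \<xi> assume \<xi>: "\<xi> \<in> PiE {..<k} (\<lambda>_. {..<p})"
    show "\<xi> \<in> C \<union> nonconst_fun k p"
    proof (cases "\<xi> \<in> nonconst_fun k p")
      case False
      have c: "\<xi> l = \<xi> 0" if "l < k" for l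
      proof (rule ccontr)
        assume "\<xi> l \<noteq> \<xi> 0"
        moreover have "0 < k" using k by simp
        ultimately have "\<exists>l<k. \<exists>l'<k. \<xi> l \<noteq> \<xi> l'" using that by blast
        with \<xi> have "\<xi> \<in> nonconst_fun k p" unfolding nonconst_fun_def by blast
        with False show False by contradiction
      qed
      have "\<xi> l = restrict (\<lambda>_. \<xi> 0) {..<k} l" for l
        using c[of l] PiE_arb[OF \<xi>, of l] by (cases "l < k") simp_all
      then have "\<xi> = restrict (\<lambda>_. \<xi> 0) {..<k}" by (rule ext)
      moreover have "\<xi> 0 < p" using PiE_mem[OF \<xi>, of 0] k by simp
      ultimately show ?thesis unfolding C_def by blast
    qed simp
  next
    fix \<xi> assume "\<xi> \<in> C \<union> nonconst_fun k p"
    moreover have "C \<subseteq> PiE {..<k} (\<lambda>_. {..<p})" by (auto simp: C_def split: if_splits)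
    ultimately show "\<xi> \<in> PiE {..<k} (\<lambda>_. {..<p})" unfolding nonconst_fun_def by blast
  qed
  have "\<xi> \<notin> nonconst_fun k p" if "\<xi> \<in> C" for \<xi>
  proof
    assume "\<xi> \<in> nonconst_fun k p"
    then obtain l l' where l: "l < k" "l' < k" "\<xi> l \<noteq> \<xi> l'" unfolding nonconst_fun_def by blast
    obtain c where "\<xi> = restrict (\<lambda>_. c) {..<k}" using \<open>\<xi> \<in> C\<close> unfolding C_def by blast
    then show False using l by simp
  qed
  then have "C \<inter> nonconst_fun k p = {}" by blast
  then show ?thesis unfolding eq C_sum[symmetric]
    by (intro sum.union_disjoint finite_nonconst_fun) (auto simp: C_def)
qed

section \<open>Sieve weights along the walk\<close>

context random_walk
begin

definition coords_dvd :: "nat \<Rightarrow> nat \<Rightarrow> 'w \<Rightarrow> complex" where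
  "coords_dvd p i \<omega> = (if \<forall>l<k. p dvd card {t \<in> {1..i}. W t \<omega> = l} then 1 else 0)"

text \<open>The two divisibility events exclude each other, so the difference already is the
  indicator that neither occurs, and it stays linear in the characters.\<close>

definition sieve :: "nat set \<Rightarrow> nat \<Rightarrow> 'w \<Rightarrow> complex" where
  "sieve P i \<omega> = (\<Prod>p\<in>P. 1 - coords_dvd p i \<omega> - coords_dvd p (i+1) \<omega>)"

text \<open>The \<open>p\<close> constant characters each have weight \<open>1 / p ^ k\<close> and
  add up to \<open>1 / p ^ (k-1)\<close> when \<open>p\<close> divides the time; this is collected
  for the times \<open>i\<close> and \<open>i + 1\<close>.\<close>

definition local_density :: "nat \<Rightarrow> nat \<Rightarrow> complex" where
  "local_density p i = 1 - ((if p dvd i then 1 else 0) + (if p dvd i + 1 then 1 else 0)) / of_nat p ^ (k-1)"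

text \<open>The summand 1 belongs to time \<open>i\<close>; the other one is the factor that step
  \<open>i+1\<close> adds to the same character.\<close>

definition local_noise :: "nat \<Rightarrow> nat \<Rightarrow> 'w \<Rightarrow> complex" where
  "local_noise p i \<omega> = (\<Sum>\<xi>\<in>nonconst_fun k p.
     phase (\<lambda>l. root_pow p (\<xi> l)) i \<omega> * (1 + root_pow p (\<xi> (W (i+1) \<omega>)))) / of_nat p ^ k"

lemma phase_eq_prod_coords:
  assumes "\<omega> \<in> space M"
  shows "phase g i \<omega> = (\<Prod>l<k. g l ^ card {t \<in> {1..i}. W t \<omega> = l})"
proof -
  have "phase g i \<omega> = (\<Prod>t\<in>{1..i}. \<Prod>l<k. if W t \<omega> = l then g l else 1)"
    unfolding phase_def
  proof (rule prod.cong)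
    fix t assume "t \<in> {1..i}"
    then have "W t \<omega> < k" using W_less assms by auto
    then show "g (W t \<omega>) = (\<Prod>l<k. if W t \<omega> = l then g l else 1)" by simp
  qed simp
  also have "\<dots> = (\<Prod>l<k. \<Prod>t\<in>{1..i}. if W t \<omega> = l then g l else 1)" by (rule prod.swap)
  also have "\<dots> = (\<Prod>l<k. g l ^ card {t \<in> {1..i}. W t \<omega> = l})"
    by (simp add: prod.inter_filter[symmetric])
  finally show ?thesis .
qed

lemma phase_mult: "phase (\<lambda>l. g l * h l) i \<omega> = phase g i \<omega> * phase h i \<omega>"
  by (simp add: phase_def prod.distrib)

lemma phase_Suc: "phase g (Suc i) \<omega> = phase g i \<omega> * g (W (Suc i) \<omega>)"
  by (simp add: phase_def)

text \<open>The first summand collects the constant characters.\<close>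

lemma coords_dvd_eq:
  assumes \<omega>: "\<omega> \<in> space M" and p: "p \<ge> 1"
  shows "coords_dvd p i \<omega> = (if p dvd i then 1 else 0) / of_nat p ^ (k-1)
     + (\<Sum>\<xi>\<in>nonconst_fun k p. phase (\<lambda>l. root_pow p (\<xi> l)) i \<omega>) / of_nat p ^ k"
proof -
  define N where "N l = card {t \<in> {1..i}. W t \<omega> = l}" for l
  have "of_nat p ^ k * coords_dvd p i \<omega> = (\<Prod>l<k. if p dvd N l then of_nat p else 0)"
  proof (cases "\<forall>l<k. p dvd N l")
    case False
    then show ?thesis by (auto simp: coords_dvd_def N_def)
  qed (simp add: coords_dvd_def N_def)
  also have "\<dots> = (\<Prod>l<k. \<Sum>c<p. root_pow p (c * N l))"
    using sum_root_pow[OF p] by simp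
  also have "\<dots> = (\<Sum>\<xi>\<in>PiE {..<k} (\<lambda>_. {..<p}). \<Prod>l<k. root_pow p (\<xi> l * N l))"
    by (rule prod_sum_PiE) auto
  also have "\<dots> = (\<Sum>\<xi>\<in>PiE {..<k} (\<lambda>_. {..<p}). phase (\<lambda>l. root_pow p (\<xi> l)) i \<omega>)"
    unfolding phase_eq_prod_coords[OF \<omega>] N_def by (simp add: root_pow_power)
  also have "\<dots> = (\<Sum>c<p. phase (\<lambda>l. root_pow p (restrict (\<lambda>_. c) {..<k} l)) i \<omega>)
      + (\<Sum>\<xi>\<in>nonconst_fun k p. phase (\<lambda>l. root_pow p (\<xi> l)) i \<omega>)"
    using k_ge_2 by (intro sum_PiE_const_nonconst) auto
  also have "(\<Sum>c<p. phase (\<lambda>l. root_pow p (restrict (\<lambda>_. c) {..<k} l)) i \<omega>) = (\<Sum>c<p. root_pow p (c * i))"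
  proof (rule sum.cong)
    fix c
    have "phase (\<lambda>l. root_pow p (restrict (\<lambda>_. c) {..<k} l)) i \<omega> = (\<Prod>t\<in>{1..i}. root_pow p c)"
      unfolding phase_def using W_less \<omega> by (intro prod.cong) auto
    then show "phase (\<lambda>l. root_pow p (restrict (\<lambda>_. c) {..<k} l)) i \<omega> = root_pow p (c * i)"
      by (simp add: root_pow_power)
  qed simp
  also have "\<dots> = of_nat p * (if p dvd i then 1 else 0)" using sum_root_pow[OF p] by simp
  finally have eq: "of_nat p ^ k * coords_dvd p i \<omega> = of_nat p * (if p dvd i then 1 else 0)
      + (\<Sum>\<xi>\<in>nonconst_fun k p. phase (\<lambda>l. root_pow p (\<xi> l)) i \<omega>)" .
  obtain k' where k': "k = Suc k'" using k_ge_2 by (cases k) auto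
  have p0: "(of_nat p :: complex) \<noteq> 0" using p by simp
  have "coords_dvd p i \<omega> = (of_nat p ^ k * coords_dvd p i \<omega>) / of_nat p ^ k" using p0 by simp
  also have "\<dots> = of_nat p * (if p dvd i then 1 else 0) / of_nat p ^ k
      + (\<Sum>\<xi>\<in>nonconst_fun k p. phase (\<lambda>l. root_pow p (\<xi> l)) i \<omega>) / of_nat p ^ k"
    unfolding eq add_divide_distrib ..
  also have "of_nat p * (if p dvd i then 1 else 0) / of_nat p ^ k = (if p dvd i then 1 else (0::complex)) / of_nat p ^ (k-1)"
    using p0 k' by simp
  finally show ?thesis .
qed

lemma sieve_factor_eq:
  assumes \<omega>: "\<omega> \<in> space M" and p: "p \<ge> 1"
  shows "1 - coords_dvd p i \<omega> - coords_dvd p (i+1) \<omega> = local_density p i - local_noise p i \<omega>"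
proof -
  have "local_noise p i \<omega> = (\<Sum>\<xi>\<in>nonconst_fun k p. phase (\<lambda>l. root_pow p (\<xi> l)) i \<omega>) / of_nat p ^ k
     + (\<Sum>\<xi>\<in>nonconst_fun k p. phase (\<lambda>l. root_pow p (\<xi> l)) (i+1) \<omega>) / of_nat p ^ k"
    unfolding local_noise_def by (simp add: phase_Suc ring_distribs sum.distrib add_divide_distrib)
  then show ?thesis
    unfolding coords_dvd_eq[OF assms] local_density_def by (simp add: add_divide_distrib)
qed

lemma sieve_insert:
  assumes "finite P" "p \<notin> P" "\<omega> \<in> space M" "p \<ge> 1"
  shows "sieve (insert p P) i \<omega> = local_density p i * sieve P i \<omega> - local_noise p i \<omega> * sieve P i \<omega>"
  using assms sieve_factor_eq[of \<omega> p i] by (simp add: sieve_def left_diff_distrib)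

text \<open>This bound allows the density to be absorbed into the weight \<open>c\<close> when
  primes are added one at a time. At most one of the two terms is subtracted, as \<open>p\<close>
  cannot divide consecutive integers.\<close>

lemma norm_local_density_le_1:
  assumes "prime p"
  shows "norm (local_density p i) \<le> 1"
proof -
  have p2: "p \<ge> 2" using assms by (rule prime_ge_2_nat)
  have "\<not> (p dvd i \<and> p dvd i + 1)" using p2 by (metis dvd_add_right_iff nat_dvd_1_iff_1 numeral_le_one_iff semiring_norm(69))
  moreover define x where "x = 1 / real p ^ (k-1)"
  have x: "0 \<le> x" "x \<le> 1" using p2 by (auto simp: x_def)
  ultimately have "local_density p i = of_real (1 - x) \<or> local_density p i = 1"
    by (auto simp: local_density_def x_def)
  then show ?thesis using x by (auto simp: norm_of_real simp del: of_real_diff)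
qed

text \<open>The exponent \<open>Q\<close>, coprime to \<open>P\<close>, is what makes induction on \<open>P\<close> possible: multiplying
  \<open>g\<close> by a nonconstant character modulo a new prime \<open>p\<close> leaves it nonconstant, and its
  order then divides \<open>Q * p\<close>.\<close>

definition sieved_phases_vanish :: "nat set \<Rightarrow> bool" where
  "sieved_phases_vanish P \<longleftrightarrow> (\<forall>g h c Q. (\<forall>l. norm (g l) = 1) \<and> (\<forall>l. norm (h l) = 1)
     \<and> (\<forall>i. norm (c i) \<le> 1) \<and> Q > 0 \<and> (\<forall>p\<in>P. coprime Q p) \<and> (\<forall>l. g l ^ Q = 1)
     \<and> (\<exists>l<k. \<exists>l'<k. g l \<noteq> g l')
     \<longrightarrow> (AE \<omega> in M. averages_to (\<lambda>i. c i * phase g i \<omega> * h (W (i+1) \<omega>) * sieve P i \<omega>) 0))"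

lemma sieved_phases_vanishD:
  fixes c :: "nat \<Rightarrow> complex"
  assumes "sieved_phases_vanish P" "\<And>l. norm (g l) = 1" "\<And>l. norm (h l) = 1"
    "\<And>i. norm (c i) \<le> 1" "Q > 0" "\<And>p. p \<in> P \<Longrightarrow> coprime Q p" "\<And>l. g l ^ Q = 1"
    "\<exists>l<k. \<exists>l'<k. g l \<noteq> g l'"
  shows "AE \<omega> in M. averages_to (\<lambda>i. c i * phase g i \<omega> * h (W (i+1) \<omega>) * sieve P i \<omega>) 0"
  using assms unfolding sieved_phases_vanish_def by blast

lemma averages_to_local_noise:
  fixes c :: "nat \<Rightarrow> complex"
  assumes van: "sieved_phases_vanish P" and P: "\<And>q. q \<in> P \<Longrightarrow> prime q" and p: "prime p" "p \<notin> P"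
    and g: "\<And>l. norm (g l) = 1" and h: "\<And>l. norm (h l) = 1" and c: "\<And>i. norm (c i) \<le> 1"
    and Q: "Q > 0" "\<And>q. q \<in> insert p P \<Longrightarrow> coprime Q q" "\<And>l. g l ^ Q = 1"
  shows "AE \<omega> in M. averages_to
     (\<lambda>i. c i * phase g i \<omega> * h (W (i+1) \<omega>) * local_noise p i \<omega> * sieve P i \<omega>) 0"
proof -
  have p1: "p \<ge> 1" using p(1) prime_ge_1_nat by blast
  define G where "G \<xi> l = g l * root_pow p (\<xi> l)" for \<xi> :: "nat \<Rightarrow> nat" and l
  define H where "H \<xi> l = h l * root_pow p (\<xi> l)" for \<xi> :: "nat \<Rightarrow> nat" and l
  have cop: "coprime (Q * p) q" if "q \<in> P" for q
    using Q(2) that P p primes_coprime[of p q] by auto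
  have GQ: "G \<xi> l ^ (Q * p) = 1" for \<xi> l
  proof -
    have "G \<xi> l ^ (Q * p) = (g l ^ Q) ^ p * root_pow p (\<xi> l) ^ (Q * p)"
      by (simp add: G_def power_mult_distrib power_mult)
    also have "\<dots> = 1" using p1 by (simp add: Q(3) root_pow_power root_pow_eq_1_iff)
    finally show ?thesis .
  qed
  have nonconst: "\<exists>l<k. \<exists>l'<k. G \<xi> l \<noteq> G \<xi> l'" if \<xi>: "\<xi> \<in> nonconst_fun k p" for \<xi>
  proof -
    obtain l l' where l: "l < k" "l' < k" "\<xi> l \<noteq> \<xi> l'" using \<xi> by (auto simp: nonconst_fun_def)
    have lt: "\<xi> l < p" "\<xi> l' < p" using \<xi> l by (auto simp: nonconst_fun_def)
    have "G \<xi> l \<noteq> G \<xi> l'"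
    proof
      assume "G \<xi> l = G \<xi> l'"
      \<comment> \<open>The power \<open>Q\<close> kills the \<open>g\<close> part and leaves a
        character modulo \<open>p\<close>; since \<open>Q\<close> is invertible modulo
        \<open>p\<close>, it cannot identify two different exponents.\<close>
      then have "G \<xi> l ^ Q = G \<xi> l' ^ Q" by simp
      then have "root_pow p (\<xi> l * Q) = root_pow p (\<xi> l' * Q)"
        by (simp add: G_def power_mult_distrib Q(3) root_pow_power)
      then have "[\<xi> l * Q = \<xi> l' * Q] (mod p)" using p1 by (simp add: root_pow_eq_iff)
      then have "[\<xi> l = \<xi> l'] (mod p)"
        using Q(2)[of p] by (subst (asm) cong_mult_rcancel_nat) (auto simp: coprime_commute)
      then show False using l lt by (simp add: cong_def)
    qed
    then show ?thesis using l by blast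
  qed
  have "AE \<omega> in M. averages_to (\<lambda>i. c i * phase (G \<xi>) i \<omega> * h (W (i+1) \<omega>) * sieve P i \<omega>) 0
      \<and> averages_to (\<lambda>i. c i * phase (G \<xi>) i \<omega> * H \<xi> (W (i+1) \<omega>) * sieve P i \<omega>) 0"
    if \<xi>: "\<xi> \<in> nonconst_fun k p" for \<xi>
    unfolding AE_conj_iff
    by (intro conjI sieved_phases_vanishD[OF van, where Q="Q * p"] nonconst[OF \<xi>] c GQ cop)
       (use Q p1 in \<open>auto simp: G_def H_def norm_mult g h\<close>)
  then have "AE \<omega> in M. \<forall>\<xi>\<in>nonconst_fun k p.
      averages_to (\<lambda>i. c i * phase (G \<xi>) i \<omega> * h (W (i+1) \<omega>) * sieve P i \<omega>) 0
      \<and> averages_to (\<lambda>i. c i * phase (G \<xi>) i \<omega> * H \<xi> (W (i+1) \<omega>) * sieve P i \<omega>) 0"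
    by (intro AE_finite_allI finite_nonconst_fun)
  then show ?thesis
  proof eventually_elim
    case (elim \<omega>)
    have "averages_to (\<lambda>i. 1 / of_nat p ^ k * (\<Sum>\<xi>\<in>nonconst_fun k p.
        c i * phase (G \<xi>) i \<omega> * h (W (i+1) \<omega>) * sieve P i \<omega>
        + c i * phase (G \<xi>) i \<omega> * H \<xi> (W (i+1) \<omega>) * sieve P i \<omega>))
        (1 / of_nat p ^ k * (\<Sum>\<xi>\<in>nonconst_fun k p. 0 + 0))"
      using elim by (intro averages_to_cmult averages_to_sum averages_to_add) auto
    moreover have "1 / of_nat p ^ k * (\<Sum>\<xi>\<in>nonconst_fun k p.
        c i * phase (G \<xi>) i \<omega> * h (W (i+1) \<omega>) * sieve P i \<omega>
        + c i * phase (G \<xi>) i \<omega> * H \<xi> (W (i+1) \<omega>) * sieve P i \<omega>)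
      = c i * phase g i \<omega> * h (W (i+1) \<omega>) * local_noise p i \<omega> * sieve P i \<omega>" for i
    proof -
      have "(\<Sum>\<xi>\<in>nonconst_fun k p.
        c i * phase (G \<xi>) i \<omega> * h (W (i+1) \<omega>) * sieve P i \<omega>
        + c i * phase (G \<xi>) i \<omega> * H \<xi> (W (i+1) \<omega>) * sieve P i \<omega>)
       = (\<Sum>\<xi>\<in>nonconst_fun k p. (c i * phase g i \<omega> * h (W (i+1) \<omega>) * sieve P i \<omega>)
          * (phase (\<lambda>l. root_pow p (\<xi> l)) i \<omega> * (1 + root_pow p (\<xi> (W (i+1) \<omega>)))))"
        unfolding G_def H_def phase_mult by (intro sum.cong refl) (simp add: algebra_simps)
      then show ?thesis unfolding local_noise_def by (simp add: sum_distrib_left[symmetric])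
    qed
    ultimately show ?case by simp
  qed
qed

text \<open>A new sieve factor is density minus noise. The density joins the weight
  \<open>c\<close>, while the noise only produces further nonconstant phases with fewer primes in
  the sieve.\<close>

lemma sieved_phases_vanish:
  assumes "finite P" "\<And>p. p \<in> P \<Longrightarrow> prime p"
  shows "sieved_phases_vanish P"
  using assms
proof (induction P)
  case empty
  show ?case unfolding sieved_phases_vanish_def
  proof (intro allI impI, elim conjE exE)
    fix g h c :: "nat \<Rightarrow> complex" and Q l l'
    assume "\<forall>l. norm (g l) = 1" "\<forall>l. norm (h l) = 1" "\<forall>i. norm (c i) \<le> 1" "l < k" "l' < k" "g l \<noteq> g l'"
    then show "AE \<omega> in M. averages_to (\<lambda>i. c i * phase g i \<omega> * h (W (i+1) \<omega>) * sieve {} i \<omega>) 0"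
      using average_nonconstant_phase[of g h l l' c] by (simp add: averages_to_def sieve_def)
  qed
next
  case (insert p P)
  then have van: "sieved_phases_vanish P" and pr: "prime p" by auto
  have p1: "p \<ge> 1" using pr prime_ge_1_nat by blast
  show ?case unfolding sieved_phases_vanish_def
  proof (intro allI impI, elim conjE)
    fix g h :: "nat \<Rightarrow> complex" and c :: "nat \<Rightarrow> complex" and Q
    assume *: "\<forall>l. norm (g l) = 1" "\<forall>l. norm (h l) = 1" "\<forall>i. norm (c i) \<le> 1" "Q > 0"
      "\<forall>p\<in>insert p P. coprime Q p" "\<forall>l. g l ^ Q = 1" "\<exists>l<k. \<exists>l'<k. g l \<noteq> g l'"
    have c': "norm (c i * local_density p i) \<le> 1" for i
      using mult_mono[of "norm (c i)" 1 "norm (local_density p i)" 1] *(3) norm_local_density_le_1[OF pr]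
      by (simp add: norm_mult)
    have 1: "AE \<omega> in M. averages_to (\<lambda>i. (c i * local_density p i) * phase g i \<omega> * h (W (i+1) \<omega>) * sieve P i \<omega>) 0"
      by (rule sieved_phases_vanishD[OF van, where Q=Q]) (use * c' in auto)
    have 2: "AE \<omega> in M. averages_to (\<lambda>i. c i * phase g i \<omega> * h (W (i+1) \<omega>) * local_noise p i \<omega> * sieve P i \<omega>) 0"
      by (rule averages_to_local_noise[OF van, where Q=Q]) (use * insert in auto)
    show "AE \<omega> in M. averages_to (\<lambda>i. c i * phase g i \<omega> * h (W (i+1) \<omega>) * sieve (insert p P) i \<omega>) 0"
      using 1 2 AE_space
    proof eventually_elim
      case (elim \<omega>)
      show ?case using averages_to_diff[OF elim(1,2)] insert elim(3) p1
        by (simp add: sieve_insert algebra_simps)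
    qed
  qed
qed

text \<open>On average, the random factor of a new prime may be replaced by its periodic density,
  because the noise averages to 0 even against the remaining sieve.\<close>

lemma averages_to_sieve_insert:
  fixes c :: "nat \<Rightarrow> complex"
  assumes P: "finite P" "\<And>q. q \<in> P \<Longrightarrow> prime q" "prime p" "p \<notin> P" and c: "\<And>i. norm (c i) \<le> 1"
    and main: "AE \<omega> in M. averages_to (\<lambda>i. c i * local_density p i * sieve P i \<omega>) L"
  shows "AE \<omega> in M. averages_to (\<lambda>i. c i * sieve (insert p P) i \<omega>) L"
proof -
  have p1: "p \<ge> 1" using P prime_ge_1_nat by blast
  have "AE \<omega> in M. averages_to (\<lambda>i. c i * phase (\<lambda>_. 1) i \<omega> * (\<lambda>_. 1) (W (i+1) \<omega>) * local_noise p i \<omega> * sieve P i \<omega>) 0"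
    by (rule averages_to_local_noise[where Q=1]) (use P c sieved_phases_vanish in auto)
  with main show ?thesis using AE_space
  proof eventually_elim
    case (elim \<omega>)
    show ?case using averages_to_diff[OF elim(1,2)] P elim(3) p1
      by (simp add: sieve_insert algebra_simps phase_def)
  qed
qed

lemma norm_class_ind: "norm (class_ind a m i) \<le> 1"
  by (simp add: class_ind_def)

text \<open>The density of a new prime \<open>p\<close> depends on whether \<open>i\<close> is 0 or
  -1 modulo \<open>p\<close>. This splits the class modulo \<open>m\<close> into classes modulo
  \<open>m * p\<close>, which is why \<open>a\<close> and \<open>m\<close> vary in the
  induction.\<close>

lemma averages_to_sieved_class:
  assumes "finite P" "\<And>p. p \<in> P \<Longrightarrow> prime p" "m \<ge> 1" "\<And>p. p \<in> P \<Longrightarrow> coprime m p"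
  shows "AE \<omega> in M. averages_to (\<lambda>i. class_ind a m i * sieve P i \<omega>)
           (1 / of_nat m * (\<Prod>p\<in>P. 1 - 2 / of_nat p ^ k))"
  using assms
proof (induction P arbitrary: a m)
  case empty
  then show ?case using averages_to_class_ind[of m a] by (simp add: sieve_def)
next
  case (insert p P)
  then have pr: "prime p" and cop: "coprime m p" by auto
  have p1: "p \<ge> 1" using pr prime_ge_1_nat by blast
  \<comment> \<open>By the Chinese remainder theorem, \<open>x\<close> represents the part of the
    class where \<open>p\<close> divides \<open>i\<close>, and \<open>y\<close> below the part where
    \<open>p\<close> divides \<open>i + 1\<close>.\<close>
  obtain x where x: "[x = a] (mod m)" "[x = 0] (mod p)"
    using binary_chinese_remainder_nat[OF cop] by blast
  obtain y where y: "[y = a] (mod m)" "[y = p - 1] (mod p)"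
    using binary_chinese_remainder_nat[OF cop] by blast
  have y': "[y + 1 = 0] (mod p)" using cong_add[OF y(2) cong_refl[of 1]] p1 by (simp add: cong_def)
  have subst_cong: "[u = v] (mod n) \<Longrightarrow> [i = u] (mod n) \<longleftrightarrow> [i = v] (mod n)" for i u v n :: nat
    by (simp add: cong_def)
  have crt: "[i = z] (mod m * p) \<longleftrightarrow> [i = z] (mod m) \<and> [i = z] (mod p)" for i z
    using cop by (intro iffI conjI coprime_cong_mult_nat)
      (auto intro: cong_dvd_modulus_nat[of _ _ "m * p"])
  have X: "class_ind a m i * (if p dvd i then 1 else 0) = class_ind x (m * p) i" for i
  proof -
    have "[i = x] (mod m * p) \<longleftrightarrow> [i = x] (mod m) \<and> [i = x] (mod p)"
      by (rule crt)
    also have "\<dots> \<longleftrightarrow> [i = a] (mod m) \<and> [i = 0] (mod p)"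
      using subst_cong[OF x(1)] subst_cong[OF x(2)] by simp
    finally show ?thesis by (auto simp: class_ind_def cong_def dvd_eq_mod_eq_0)
  qed
  have Y: "class_ind a m i * (if p dvd i + 1 then 1 else 0) = class_ind y (m * p) i" for i
  proof -
    have "[i = y] (mod m * p) \<longleftrightarrow> [i = y] (mod m) \<and> [i = y] (mod p)"
      by (rule crt)
    also have "[i = y] (mod p) \<longleftrightarrow> [i + 1 = y + 1] (mod p)" by (rule cong_add_rcancel_nat[symmetric])
    also have "[i = y] (mod m) \<and> [i + 1 = y + 1] (mod p) \<longleftrightarrow> [i = a] (mod m) \<and> [i + 1 = 0] (mod p)"
      by (simp only: subst_cong[OF y(1)] subst_cong[OF y'])
    finally show ?thesis by (auto simp: class_ind_def cong_def dvd_eq_mod_eq_0)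
  qed
  have mp: "m * p \<ge> 1" using insert.prems(2) p1 by simp
  have copmp: "coprime (m * p) q" if "q \<in> P" for q
    using insert.prems(1,3)[of q] insert.hyps(2) that pr primes_coprime[of p q] by auto
  define pp where "pp = (\<Prod>p\<in>P. 1 - 2 / complex_of_nat p ^ k)"
  have "AE \<omega> in M. averages_to (\<lambda>i. class_ind b m' i * sieve P i \<omega>) (1 / of_nat m' * pp)"
    if "m' = m \<or> m' = m * p" for b m'
    unfolding pp_def
  proof (rule insert.IH)
    show "m' \<ge> 1" using that mp insert.prems(2) by blast
    show "coprime m' q" if "q \<in> P" for q
      using \<open>m' = m \<or> m' = m * p\<close> copmp[OF that] insert.prems(3)[of q] that by blast
    show "prime q" if "q \<in> P" for q using insert.prems(1)[of q] that by blast
  qed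
  then have "AE \<omega> in M. averages_to (\<lambda>i. class_ind a m i * sieve P i \<omega>) (1 / of_nat m * pp)"
    "AE \<omega> in M. averages_to (\<lambda>i. class_ind x (m*p) i * sieve P i \<omega>) (1 / of_nat (m*p) * pp)"
    "AE \<omega> in M. averages_to (\<lambda>i. class_ind y (m*p) i * sieve P i \<omega>) (1 / of_nat (m*p) * pp)"
    by blast+
  then have main: "AE \<omega> in M. averages_to (\<lambda>i. class_ind a m i * local_density p i * sieve P i \<omega>)
      (1 / of_nat m * pp - 1 / of_nat p ^ (k-1) * (1 / of_nat (m*p) * pp + 1 / of_nat (m*p) * pp))"
  proof eventually_elim
    case (elim \<omega>)
    have "class_ind a m i * sieve P i \<omega> - 1 / of_nat p ^ (k-1) *
        (class_ind x (m*p) i * sieve P i \<omega> + class_ind y (m*p) i * sieve P i \<omega>)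
       = class_ind a m i * local_density p i * sieve P i \<omega>" for i
      unfolding X[symmetric] Y[symmetric] local_density_def by (simp add: algebra_simps add_divide_distrib)
    then show ?case
      using averages_to_diff[OF elim(1) averages_to_cmult[OF averages_to_add[OF elim(2,3)]], of "1 / of_nat p ^ (k-1)"]
      by simp
  qed
  \<comment> \<open>Two subclasses, each with share \<open>1 / p\<close> of the class and weight
    \<open>1 / p ^ (k-1)\<close>, remove the proportion \<open>2 / p ^ k\<close>.\<close>
  have lim: "1 / of_nat m * pp - 1 / of_nat p ^ (k-1) * (1 / of_nat (m*p) * pp + 1 / of_nat (m*p) * pp)
      = 1 / of_nat m * (\<Prod>p\<in>insert p P. 1 - 2 / complex_of_nat p ^ k)"
  proof -
    obtain k' where k': "k = Suc k'" using k_ge_2 by (cases k) auto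
    have nz: "(of_nat p :: complex) \<noteq> 0" "(of_nat m :: complex) \<noteq> 0" using p1 insert by auto
    have eq: "(\<Prod>p\<in>insert p P. 1 - 2 / complex_of_nat p ^ k) = (1 - 2 / of_nat p ^ k) * pp"
      using insert.hyps by (simp add: pp_def)
    show ?thesis unfolding eq using nz by (simp add: k' field_simps)
  qed
  show ?case unfolding lim[symmetric]
    by (rule averages_to_sieve_insert[OF _ _ pr _ norm_class_ind main])
       (use insert.hyps insert.prems in auto)
qed

text \<open>If \<open>p\<close> divides \<open>m\<close>, the density at \<open>p\<close> is
  constant on the class and can be pulled out. This is the only place where the limit acquires its
  dependence on \<open>a\<close>.\<close>

lemma averages_to_sieved_class_dvd:
  assumes P: "finite P" "\<And>q. q \<in> P \<Longrightarrow> prime q" "m \<ge> 1" "\<And>q. q \<in> P \<Longrightarrow> coprime m q"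
    and p: "prime p" "p dvd m"
  shows "AE \<omega> in M. averages_to (\<lambda>i. class_ind a m i * sieve (insert p P) i \<omega>)
           (local_density p a * (1 / of_nat m * (\<Prod>p\<in>P. 1 - 2 / of_nat p ^ k)))"
proof (rule averages_to_sieve_insert)
  have eq: "class_ind a m i * local_density p i = local_density p a * class_ind a m i" for i
  proof (cases "i mod m = a mod m")
    case True
    then have ia: "[i = a] (mod p)" by (intro cong_dvd_modulus_nat[OF _ p(2)]) (simp add: cong_def)
    then have "[i + 1 = a + 1] (mod p)" by (simp only: cong_add_rcancel_nat)
    with ia have "p dvd i \<longleftrightarrow> p dvd a" "p dvd i + 1 \<longleftrightarrow> p dvd a + 1"
      by (auto dest: cong_dvd_iff)
    then show ?thesis by (simp add: local_density_def)
  qed (simp add: class_ind_def)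
  show "AE \<omega> in M. averages_to (\<lambda>i. class_ind a m i * local_density p i * sieve P i \<omega>)
      (local_density p a * (1 / of_nat m * (\<Prod>p\<in>P. 1 - 2 / of_nat p ^ k)))"
  proof -
    have "AE \<omega> in M. averages_to (\<lambda>i. class_ind a m i * sieve P i \<omega>)
        (1 / of_nat m * (\<Prod>p\<in>P. 1 - 2 / of_nat p ^ k))"
      by (rule averages_to_sieved_class) (use P in auto)
    then show ?thesis
    proof eventually_elim
      case (elim \<omega>)
      then show ?case using averages_to_cmult[OF elim] unfolding eq by (simp add: mult.assoc)
    qed
  qed
  show "p \<notin> P"
  proof
    assume "p \<in> P"
    then have "p dvd 1" using P(4)[of p] p(2) coprime_common_divisor_nat[of m p p] by simp
    then show False using p(1) by simp
  qed
qed (use P p norm_class_ind in auto)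

end

section \<open>The contribution of large primes\<close>

lemma sin_pi_ge_id:
  fixes x :: real
  assumes "0 \<le> x" "x \<le> 1/2"
  shows "x \<le> sin (pi * x)"
proof (cases "x \<le> 1/3")
  case True
  \<comment> \<open>Up to \<open>pi / 3\<close> the cosine is at least \<open>1/2\<close>, so the
    sine is at least half its argument, and \<open>pi / 2 \<ge> 1\<close>. Beyond, monotonicity and
    the value at \<open>pi / 3\<close> suffice.\<close>
  have "sin 0 - 0 / 2 \<le> sin (pi * x) - (pi * x) / 2"
  proof (rule DERIV_nonneg_imp_nondecreasing[where f="\<lambda>t. sin t - t / 2"])
    show "0 \<le> pi * x" using assms by simp
    fix t assume t: "0 \<le> t" "t \<le> pi * x"
    have "pi * x \<le> pi / 3" using mult_left_mono[OF True, of pi] by simp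
    then have "t \<le> pi / 3" using t by linarith
    then have "cos (pi/3) \<le> cos t" using t by (intro cos_monotone_0_pi_le) auto
    then have "0 \<le> cos t - 1/2" by (simp add: cos_60)
    moreover have "((\<lambda>t. sin t - t / 2) has_real_derivative cos t - 1/2) (at t)"
      by (auto intro!: derivative_eq_intros)
    ultimately show "\<exists>d. ((\<lambda>t. sin t - t / 2) has_real_derivative d) (at t) \<and> 0 \<le> d" by blast
  qed
  moreover have "2 * x \<le> pi * x" using assms pi_ge_two by (intro mult_right_mono) auto
  ultimately show ?thesis by simp
next
  case False
  have "1/2 \<le> sin (pi/3)" by (simp add: sin_60)
  also have "\<dots> \<le> sin (pi * x)"
  proof (rule sin_monotone_2pi_le)
    show "- (pi/2) \<le> pi/3" using pi_gt_zero by linarith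
    show "pi/3 \<le> pi * x" using mult_left_mono[of "1/3" x pi] False by simp
    show "pi * x \<le> pi/2" using mult_left_mono[of x "1/2" pi] assms by simp
  qed
  finally show ?thesis using assms by simp
qed

text \<open>The parabola has the same simple zeros at 0 and 1 as the sine, and its reciprocal splits
  into partial fractions, which makes sums over frequencies explicit.\<close>

lemma sin_pi_ge:
  fixes x :: real
  assumes "0 \<le> x" "x \<le> 1"
  shows "x * (1 - x) \<le> sin (pi * x)"
proof (cases "x \<le> 1/2")
  case True
  have "x * (1 - x) \<le> x" using assms by (simp add: mult_left_le)
  also have "\<dots> \<le> sin (pi * x)" using sin_pi_ge_id[of x] assms True by simp
  finally show ?thesis .
next
  case False
  have "x * (1 - x) \<le> 1 - x" using assms by (simp add: mult_left_le_one_le)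
  also have "\<dots> \<le> sin (pi * (1 - x))" using sin_pi_ge_id[of "1 - x"] assms False by simp
  also have "\<dots> = sin (pi * x)" using sin_pi_minus[of "pi * x"] by (simp add: right_diff_distrib)
  finally show ?thesis .
qed

text \<open>Multiply by \<open>(1 + u) ^ N\<close>: the product is at most 1, while Bernoulli bounds
  the multiplier below. The bound is uniform in \<open>u\<close>, which will be as small as order
  \<open>1 / p^2\<close>.\<close>

lemma power_one_minus_le:
  fixes u :: real
  assumes "0 < u" "u \<le> 1"
  shows "(1 - u) ^ N \<le> 1 / ((real N + 1) * u)"
proof -
  have "(1 - u) ^ N * ((real N + 1) * u) \<le> (1 - u) ^ N * (1 + u) ^ N"
  proof (intro mult_left_mono)
    have "(real N + 1) * u \<le> 1 + real N * u" using assms by (simp add: algebra_simps)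
    also have "\<dots> \<le> (1 + u) ^ N" using assms by (intro Bernoulli_inequality) simp
    finally show "(real N + 1) * u \<le> (1 + u) ^ N" .
  qed (use assms in simp)
  also have "\<dots> = (1 - u\<^sup>2) ^ N"
    by (simp add: power_mult_distrib[symmetric] power2_eq_square algebra_simps)
  also have "\<dots> \<le> 1" using assms by (intro power_le_one) (simp_all add: power_le_one)
  finally show ?thesis using assms by (simp add: pos_le_divide_eq)
qed

lemma sum_inverse_le: "n \<ge> 1 \<Longrightarrow> (\<Sum>c\<in>{1..n}. 1 / real c) \<le> 1 + ln (real n)"
proof (induction n rule: nat_induct_at_least)
  case (Suc n)
  have "ln (real n / real (Suc n)) \<le> real n / real (Suc n) - 1"
    using Suc by (intro ln_le_minus_one) simp
  also have "\<dots> = - (1 / real (Suc n))" by (simp add: field_simps)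
  finally have "1 / real (Suc n) \<le> ln (real (Suc n)) - ln (real n)"
    using Suc.hyps by (simp add: ln_div)
  then show ?case using Suc.IH by simp
qed simp

text \<open>Partial fractions give \<open>p / c + p / (p - c)\<close>, hence two harmonic
  sums.\<close>

lemma sum_inverse_parabola_le:
  assumes "p \<ge> 2"
  shows "(\<Sum>c\<in>{1..<p}. 1 / (real c / real p * (1 - real c / real p))) \<le> 2 * real p * (1 + ln (real p))"
proof -
  have "(\<Sum>c\<in>{1..<p}. 1 / (real c / real p * (1 - real c / real p)))
      = (\<Sum>c\<in>{1..<p}. real p * (1 / real c) + real p * (1 / real (p - c)))"
  proof (rule sum.cong)
    fix c assume "c \<in> {1..<p}"
    then have "real c > 0" "real p - real c > 0" "real (p - c) = real p - real c" "real p > 0" by auto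
    then show "1 / (real c / real p * (1 - real c / real p)) = real p * (1 / real c) + real p * (1 / real (p - c))"
      by (simp add: divide_simps) (simp add: algebra_simps)
  qed simp
  also have "\<dots> = real p * (\<Sum>c\<in>{1..<p}. 1 / real c) + real p * (\<Sum>c\<in>{1..<p}. 1 / real (p - c))"
    by (simp only: sum.distrib sum_distrib_left)
  also have "(\<Sum>c\<in>{1..<p}. 1 / real (p - c)) = (\<Sum>c\<in>{1..<p}. 1 / real c)"
    by (rule sum.reindex_bij_witness[of _ "\<lambda>c. p - c" "\<lambda>c. p - c"]) auto
  also have "real p * (\<Sum>c\<in>{1..<p}. 1 / real c) + real p * (\<Sum>c\<in>{1..<p}. 1 / real c)
      \<le> real p * (1 + ln (real p)) + real p * (1 + ln (real p))"
  proof -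
    have eq: "{1..<p} = {1..p-1}" using assms by auto
    have "(\<Sum>c\<in>{1..<p}. 1 / real c) \<le> 1 + ln (real (p - 1))"
      unfolding eq using assms by (intro sum_inverse_le) auto
    also have "\<dots> \<le> 1 + ln (real p)" using assms by simp
    finally show ?thesis by (intro add_mono mult_left_mono) auto
  qed
  finally show ?thesis by (simp only: mult_2 distrib_right)
qed

text \<open>A prime dividing all coordinates divides the time, so no other prime can matter. Without
  this restriction the expected number of hits would be governed by the divergent sum of
  \<open>1/p\<close>.\<close>

definition large_factors :: "nat \<Rightarrow> nat \<Rightarrow> nat set" where
  "large_factors y i = {p. prime p \<and> y < p \<and> p dvd i}"

lemma large_factors_subset: "i \<ge> 1 \<Longrightarrow> large_factors y i \<subseteq> prime_factors i"
  by (auto simp: large_factors_def prime_factors_dvd)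

lemma finite_large_factors: "i \<ge> 1 \<Longrightarrow> finite (large_factors y i)"
  using large_factors_subset finite_subset by blast

lemma card_large_factors_le:
  assumes i: "i \<ge> 1"
  shows "real (card (large_factors y i)) \<le> log 2 (real i)"
proof -
  have "2 ^ card (prime_factors i) = (\<Prod>p\<in>prime_factors i. 2::nat)" by simp
  also have "\<dots> \<le> (\<Prod>p\<in>prime_factors i. p ^ multiplicity p i)"
  proof (intro prod_mono conjI)
    fix p assume p: "p \<in> prime_factors i"
    then have "prime p" "multiplicity p i \<ge> 1" by (auto simp: prime_factors_multiplicity)
    then have "2 \<le> p" using prime_ge_2_nat by blast
    moreover have "p ^ 1 \<le> p ^ multiplicity p i"
      by (rule power_increasing) (use \<open>2 \<le> p\<close> \<open>multiplicity p i \<ge> 1\<close> in auto)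
    ultimately show "2 \<le> p ^ multiplicity p i" by simp
  qed simp
  also have "\<dots> = i" using i prime_factorization_nat[of i] by simp
  finally have "real (2 ^ card (prime_factors i)) \<le> real i" by (simp only: of_nat_le_iff)
  then have "2 powr real (card (prime_factors i)) \<le> real i" by (simp add: powr_realpow)
  then have "real (card (prime_factors i)) \<le> log 2 (real i)"
    using i by (simp add: le_log_iff)
  moreover have "card (large_factors y i) \<le> card (prime_factors i)"
    using i by (intro card_mono large_factors_subset) auto
  ultimately show ?thesis by linarith
qed

section \<open>Characters of the first coordinate\<close>

context random_walk
begin

definition first_phase :: "nat \<Rightarrow> nat \<Rightarrow> nat \<Rightarrow> complex" where
  "first_phase p c l = (if l = 0 then root_pow p c else 1)"

lemma norm_first_phase: "norm (first_phase p c l) = 1"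
  by (simp add: first_phase_def)

lemma step_mean_first_phase:
  assumes "\<alpha> \<in> A"
  shows "step_mean \<alpha> (first_phase p c) = 1 - of_real (\<alpha> 0) + of_real (\<alpha> 0) * root_pow p c"
proof -
  have 0: "0 \<in> {..<k}" using k_ge_2 by simp
  have "step_mean \<alpha> (first_phase p c) = of_real (\<alpha> 0) * root_pow p c + (\<Sum>l\<in>{..<k}-{0}. of_real (\<alpha> l))"
    unfolding step_mean_def by (subst sum.remove[OF _ 0]) (simp_all add: first_phase_def)
  also have "(\<Sum>l\<in>{..<k}-{0}. complex_of_real (\<alpha> l)) = of_real (1 - \<alpha> 0)"
  proof -
    have "(\<Sum>l\<in>{..<k}-{0}. \<alpha> l) = 1 - \<alpha> 0"
      using A_sum[OF assms] sum.remove[OF _ 0, of \<alpha>] by simp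
    then show ?thesis by (simp only: of_real_sum[symmetric])
  qed
  finally show ?thesis by simp
qed

text \<open>With \<open>b\<close> the weight of direction 0, \<open>b * (1 - b)\<close> is the
  variance of the coordinate increment. Keeping the dependence on \<open>c / p\<close> explicit is
  essential here, since \<open>p\<close> is unbounded and no single contraction factor serves all
  characters.\<close>

lemma norm_step_mean_first_phase:
  assumes "\<alpha> \<in> A"
  shows "(norm (step_mean \<alpha> (first_phase p c)))\<^sup>2
    = 1 - 4 * \<alpha> 0 * (1 - \<alpha> 0) * (sin (pi * (real c / real p)))\<^sup>2"
proof -
  define \<theta> b where "\<theta> = pi * (real c / real p)" and "b = \<alpha> 0"
  have rp: "root_pow p c = cis (2 * \<theta>)"
    by (simp add: root_pow_def cis_conv_exp \<theta>_def mult_ac)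
  have "(norm (step_mean \<alpha> (first_phase p c)))\<^sup>2 = (1 - b + b * cos (2 * \<theta>))\<^sup>2 + (b * sin (2 * \<theta>))\<^sup>2"
    unfolding step_mean_first_phase[OF assms] rp b_def[symmetric] cmod_power2 by simp
  also have "\<dots> = (1 - b)\<^sup>2 + 2 * b * (1 - b) * cos (2 * \<theta>) + b\<^sup>2 * ((sin (2 * \<theta>))\<^sup>2 + (cos (2 * \<theta>))\<^sup>2)"
    by (simp only: power2_eq_square) (simp only: algebra_simps)
  also have "\<dots> = (1 - b)\<^sup>2 + 2 * b * (1 - b) * cos (2 * \<theta>) + b\<^sup>2"
    by (simp only: sin_cos_squared_add mult_1_right)
  also have "\<dots> = 1 - 4 * b * (1 - b) * (sin \<theta>)\<^sup>2"
    unfolding cos_double_sin by (simp add: power2_eq_square algebra_simps)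
  finally show ?thesis by (simp only: \<theta>_def b_def)
qed

lemma first_phase_spread:
  "\<exists>\<eta>. 0 < \<eta> \<and> \<eta> \<le> 1 \<and> (\<forall>\<alpha>\<in>A. \<eta> \<le> 4 * \<alpha> 0 * (1 - \<alpha> 0))"
proof -
  define R where "R = insert 1 ((\<lambda>\<alpha>. 4 * \<alpha> 0 * (1 - \<alpha> 0)) ` A)"
  have R: "finite R" "R \<noteq> {}" using finite_A by (auto simp: R_def)
  have "0 < x" if x: "x \<in> R" for x
  proof (cases "x = 1")
    case False
    then obtain \<alpha> where "\<alpha> \<in> A" "x = 4 * \<alpha> 0 * (1 - \<alpha> 0)" using x by (auto simp: R_def)
    then show ?thesis using A_bounds[of \<alpha> 0] k_ge_2 by simp
  qed simp
  then have "0 < Min R" using R by simp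
  moreover have "1 \<in> R" "\<forall>\<alpha>\<in>A. 4 * \<alpha> 0 * (1 - \<alpha> 0) \<in> R" by (auto simp: R_def)
  then have "Min R \<le> 1" "\<forall>\<alpha>\<in>A. Min R \<le> 4 * \<alpha> 0 * (1 - \<alpha> 0)" using R Min_le by blast+
  ultimately show ?thesis by blast
qed

text \<open>Fixed once, so that all primes and frequencies share the same constant.\<close>

definition spread :: real where
  "spread = (SOME \<eta>. 0 < \<eta> \<and> \<eta> \<le> 1 \<and> (\<forall>\<alpha>\<in>A. \<eta> \<le> 4 * \<alpha> 0 * (1 - \<alpha> 0)))"

lemma spread: "0 < spread" "spread \<le> 1" "\<alpha> \<in> A \<Longrightarrow> spread \<le> 4 * \<alpha> 0 * (1 - \<alpha> 0)"
  using someI_ex[OF first_phase_spread] unfolding spread_def[symmetric] by blast+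

text \<open>Each factor is at most \<open>sqrt (1 - u)\<close>, and there are
  \<open>j - i - 1\<close> of them; the \<open>N + 1\<close> in the power bound restores exactly
  \<open>j - i\<close>. The square root of \<open>u\<close> yields the parabola.\<close>

lemma prod_first_phase_le:
  assumes c: "1 \<le> c" "c < p" and ij: "i < j"
  shows "(\<Prod>t\<in>{i+2..j}. norm (step_mean (ty t) (first_phase p c)))
     \<le> 1 / (sqrt spread * sqrt (real j - real i)) * (1 / (real c / real p * (1 - real c / real p)))"
proof -
  define x u N where "x = real c / real p" and "u = spread * (x * (1 - x))\<^sup>2" and "N = j - i - 1"
  have x: "0 < x" "x < 1" using c by (auto simp: x_def)
  have w: "0 < x * (1 - x)" "x * (1 - x) \<le> 1" using x by (auto intro: mult_le_one)
  have u: "0 < u" "u \<le> 1"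
    unfolding u_def using w spread
    by (auto intro!: mult_le_one power_le_one mult_pos_pos zero_less_power simp del: zero_less_power_eq)
  have each: "norm (step_mean (ty t) (first_phase p c)) \<le> sqrt (1 - u)" if "t \<in> {i+2..j}" for t
  proof (rule real_le_rsqrt)
    have tA: "ty t \<in> A" using ty_in_A that by auto
    have "(x * (1 - x))\<^sup>2 \<le> (sin (pi * x))\<^sup>2"
      using sin_pi_ge[of x] x w by (intro power_mono) auto
    then have "u \<le> 4 * ty t 0 * (1 - ty t 0) * (sin (pi * x))\<^sup>2"
      unfolding u_def using spread(1) spread(3)[OF tA] by (intro mult_mono) auto
    then show "(norm (step_mean (ty t) (first_phase p c)))\<^sup>2 \<le> 1 - u"
      unfolding norm_step_mean_first_phase[OF tA] x_def by linarith
  qed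
  have "(\<Prod>t\<in>{i+2..j}. norm (step_mean (ty t) (first_phase p c))) \<le> (\<Prod>t\<in>{i+2..j}. sqrt (1 - u))"
    using each by (intro prod_mono) auto
  also have "\<dots> = sqrt ((1 - u) ^ N)" by (simp add: N_def Suc_diff_le real_sqrt_power)
  also have "\<dots> \<le> sqrt (1 / ((real N + 1) * u))"
    using power_one_minus_le[OF u] by (rule real_sqrt_le_mono)
  also have "real N + 1 = real j - real i" using ij by (auto simp: N_def)
  also have "sqrt (1 / ((real j - real i) * u)) = 1 / (sqrt spread * sqrt (real j - real i)) * (1 / (x * (1 - x)))"
    using w by (simp add: u_def real_sqrt_divide real_sqrt_mult)
  finally show ?thesis by (simp only: x_def)
qed

text \<open>Poor contraction occurs only for \<open>c\<close> near 0 or \<open>p\<close>, so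
  averaging over all frequencies costs no more than a logarithm.\<close>

lemma sum_prod_first_phase_le:
  assumes p: "p \<ge> 2" and ij: "i < j"
  shows "(\<Sum>c\<in>{1..<p}. 1 / real p * (\<Prod>t\<in>{i+2..j}. norm (step_mean (ty t) (first_phase p c))))
     \<le> 2 * (1 + ln (real p)) / (sqrt spread * sqrt (real j - real i))"
proof -
  define s where "s = sqrt spread * sqrt (real j - real i)"
  have s: "s > 0" using spread ij by (simp add: s_def)
  have "(\<Sum>c\<in>{1..<p}. 1 / real p * (\<Prod>t\<in>{i+2..j}. norm (step_mean (ty t) (first_phase p c))))
     \<le> (\<Sum>c\<in>{1..<p}. 1 / real p * (1 / s * (1 / (real c / real p * (1 - real c / real p)))))"
    unfolding s_def using prod_first_phase_le[OF _ _ ij] by (intro sum_mono mult_left_mono) auto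
  also have "\<dots> = 1 / (real p * s) * (\<Sum>c\<in>{1..<p}. 1 / (real c / real p * (1 - real c / real p)))"
    unfolding sum_distrib_left by (intro sum.cong refl) simp
  also have "\<dots> \<le> 1 / (real p * s) * (2 * real p * (1 + ln (real p)))"
    using s by (intro mult_left_mono sum_inverse_parabola_le[OF p]) auto
  also have "\<dots> = 2 * (1 + ln (real p)) / s" using p by simp
  finally show ?thesis by (simp only: s_def)
qed

text \<open>For each large prime the frequency \<open>c = 0\<close> is left out; those terms form
  the deterministic sum of \<open>1/p\<close>.\<close>

definition tail_noise :: "nat \<Rightarrow> nat \<Rightarrow> 'w \<Rightarrow> complex" where
  "tail_noise y i \<omega> = (\<Sum>(p, c)\<in>Sigma (large_factors y i) (\<lambda>p. {1..<p}). of_real (1 / real p) * phase (first_phase p c) i \<omega>)"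

text \<open>A majorant for the event that some prime above \<open>y\<close> divides the whole
  position. Unlike the indicator of a union, the count is additive over primes and hence a sum of
  characters.\<close>

definition first_coord_hits :: "nat \<Rightarrow> nat \<Rightarrow> 'w \<Rightarrow> nat" where
  "first_coord_hits y i \<omega> = card {p \<in> large_factors y i. p dvd card {t \<in> {1..i}. W t \<omega> = 0}}"

lemma phase_first_phase:
  "phase (first_phase p c) i \<omega> = root_pow p (c * card {t \<in> {1..i}. W t \<omega> = 0})"
  unfolding phase_def first_phase_def
  by (simp add: prod.inter_filter[symmetric] root_pow_power)

lemma first_coord_hits_eq:
  assumes i: "i \<ge> 1"
  shows "of_nat (first_coord_hits y i \<omega>) = tail_noise y i \<omega> + of_real (\<Sum>p\<in>large_factors y i. 1 / real p)"
proof -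
  define N where "N = card {t \<in> {1..i}. W t \<omega> = 0}"
  have "tail_noise y i \<omega> = (\<Sum>p\<in>large_factors y i. \<Sum>c\<in>{1..<p}. of_real (1 / real p) * root_pow p (c * N))"
    unfolding tail_noise_def phase_first_phase N_def
    by (subst sum.Sigma[symmetric]) (use finite_large_factors[OF i] in auto)
  also have "\<dots> = (\<Sum>p\<in>large_factors y i. (if p dvd N then 1 else 0) - of_real (1 / real p))"
  proof (rule sum.cong)
    fix p assume "p \<in> large_factors y i"
    then have p: "p \<ge> 1" using prime_ge_1_nat by (auto simp: large_factors_def)
    have "{..<p} = insert 0 {1..<p}" using p by auto
    then have "(\<Sum>c<p. root_pow p (c * N)) = root_pow p 0 + (\<Sum>c\<in>{1..<p}. root_pow p (c * N))"
      by simp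
    then have e: "(\<Sum>c\<in>{1..<p}. root_pow p (c * N)) = (if p dvd N then of_nat p else 0) - 1"
      using sum_root_pow[OF p, of N] by (simp add: root_pow_def algebra_simps)
    show "(\<Sum>c\<in>{1..<p}. of_real (1 / real p) * root_pow p (c * N)) = (if p dvd N then 1 else 0) - of_real (1 / real p)"
      unfolding sum_distrib_left[symmetric] e using p by (simp add: algebra_simps)
  qed simp
  also have "\<dots> = (\<Sum>p\<in>large_factors y i. if p dvd N then 1 else 0) - of_real (\<Sum>p\<in>large_factors y i. 1 / real p)"
    by (simp add: sum_subtractf)
  also have "(\<Sum>p\<in>large_factors y i. if p dvd N then 1 else 0) = (of_nat (first_coord_hits y i \<omega>) :: complex)"
    unfolding first_coord_hits_def N_def using finite_large_factors[OF i]
    by (simp add: sum.If_cases Int_def)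
  finally show ?thesis by simp
qed

lemma norm_tail_noise_le:
  assumes i: "i \<ge> 1"
  shows "norm (tail_noise y i \<omega>) \<le> card (large_factors y i)"
proof -
  have "norm (tail_noise y i \<omega>) \<le> (\<Sum>(p, c)\<in>Sigma (large_factors y i) (\<lambda>p. {1..<p}). 1 / real p)"
    unfolding tail_noise_def
    by (rule sum_norm_le) (auto simp: norm_divide norm_phase norm_first_phase)
  also have "\<dots> = (\<Sum>p\<in>large_factors y i. \<Sum>c\<in>{1..<p}. 1 / real p)"
    by (subst sum.Sigma[symmetric]) (use finite_large_factors[OF i] in auto)
  also have "\<dots> \<le> (\<Sum>p\<in>large_factors y i. 1)"
  proof (rule sum_mono)
    fix p
    show "(\<Sum>c\<in>{1..<p}. 1 / real p) \<le> 1" by (cases "p = 0") (simp_all add: divide_simps)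
  qed
  finally show ?thesis by simp
qed

text \<open>The estimate is deliberately asymmetric: all decay comes from the characters at the
  later time \<open>j\<close>, and the earlier sum enters only through its total weight.\<close>

lemma norm_expectation_phase_sums_le:
  fixes g g' :: "'b \<Rightarrow> nat \<Rightarrow> complex" and v v' :: "'b \<Rightarrow> real"
  assumes fin: "finite S" "finite S'" and ij: "i < j"
    and g: "\<And>s l. norm (g s l) = 1" "\<And>s l. norm (g' s l) = 1"
    and v: "\<And>s. v s \<ge> 0" "\<And>s. v' s \<ge> 0"
  shows "norm (\<integral>\<omega>. (\<Sum>s\<in>S. of_real (v s) * phase (g s) i \<omega>) * cnj (\<Sum>s\<in>S'. of_real (v' s) * phase (g' s) j \<omega>) \<partial>M)
    \<le> (\<Sum>s\<in>S. v s) * (\<Sum>s\<in>S'. v' s * (\<Prod>t\<in>{i+2..j}. norm (step_mean (ty t) (g' s))))"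
proof -
  define I where "I s s' = (\<integral>\<omega>. phase (g s) i \<omega> * cnj (phase (g' s') j \<omega>) \<partial>M)" for s s'
  have [measurable]: "cnj \<in> borel_measurable borel"
    by (intro borel_measurable_continuous_onI continuous_intros)
  note phase_measurable[measurable]
  have int: "integrable M (\<lambda>\<omega>. phase (g s) i \<omega> * cnj (phase (g' s') j \<omega>))" for s s'
    by (rule integrable_const_bound[where B=1]) (auto simp: norm_mult norm_phase g)
  have I: "norm (I s s') \<le> (\<Prod>t\<in>{i+2..j}. norm (step_mean (ty t) (g' s')))" for s s'
    using phase_correlation_le[of "g s" "g' s'" "\<lambda>_. 1" "\<lambda>_. 1", OF g(1) g(2) _ _ ij] by (simp add: I_def)
  have eq: "(\<Sum>s\<in>S. of_real (v s) * phase (g s) i \<omega>) * cnj (\<Sum>s\<in>S'. of_real (v' s) * phase (g' s) j \<omega>)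
     = (\<Sum>s\<in>S. \<Sum>s'\<in>S'. of_real (v s * v' s') * (phase (g s) i \<omega> * cnj (phase (g' s') j \<omega>)))" for \<omega>
    unfolding cnj_sum sum_product by (intro sum.cong refl) simp
  have "(\<integral>\<omega>. (\<Sum>s\<in>S. of_real (v s) * phase (g s) i \<omega>) * cnj (\<Sum>s\<in>S'. of_real (v' s) * phase (g' s) j \<omega>) \<partial>M)
     = (\<Sum>s\<in>S. \<Sum>s'\<in>S'. of_real (v s * v' s') * I s s')"
    unfolding eq I_def
    by (subst Bochner_Integration.integral_sum, intro Bochner_Integration.integrable_sum integrable_mult_right int,
        intro sum.cong refl, subst Bochner_Integration.integral_sum, intro integrable_mult_right int)
       (intro sum.cong refl Bochner_Integration.integral_mult_right_zero)
  also have "norm \<dots> \<le> (\<Sum>s\<in>S. \<Sum>s'\<in>S'. v s * v' s' * (\<Prod>t\<in>{i+2..j}. norm (step_mean (ty t) (g' s'))))"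
  proof (intro sum_norm_le)
    fix s s'
    show "norm (of_real (v s * v' s') * I s s') \<le> v s * v' s' * (\<Prod>t\<in>{i+2..j}. norm (step_mean (ty t) (g' s')))"
      using I[of s s'] v by (simp add: norm_mult mult_left_mono)
  qed
  also have "\<dots> = (\<Sum>s\<in>S. v s) * (\<Sum>s\<in>S'. v' s * (\<Prod>t\<in>{i+2..j}. norm (step_mean (ty t) (g' s))))"
    unfolding sum_product by (intro sum.cong refl) simp
  finally show ?thesis .
qed

text \<open>Three logarithms meet: the number of large primes dividing \<open>i\<close>, the number
  dividing \<open>j\<close>, and the sum over frequencies for each of the latter.\<close>

lemma tail_noise_correlation_le:
  assumes i: "i \<ge> 1" and ij: "i < j"
  shows "norm (\<integral>\<omega>. tail_noise y i \<omega> * cnj (tail_noise y j \<omega>) \<partial>M)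
    \<le> (log 2 (real j))\<^sup>2 * (2 * (1 + ln (real j)) / sqrt spread) / sqrt (real j - real i)"
proof -
  have j: "j \<ge> 1" using i ij by simp
  define S where "S i = Sigma (large_factors y i) (\<lambda>p. {1..<p})" for i
  define D where "D = sqrt spread * sqrt (real j - real i)"
  have D: "D > 0" using spread ij by (simp add: D_def)
  have fin: "finite (S i)" "finite (S j)" using finite_large_factors[OF i] finite_large_factors[OF j]
    by (auto simp: S_def)
  have tn: "tail_noise y i \<omega> = (\<Sum>s\<in>S i. of_real (1 / real (fst s)) * phase (first_phase (fst s) (snd s)) i \<omega>)" for i \<omega>
    unfolding tail_noise_def S_def by (simp add: case_prod_beta)
  have "norm (\<integral>\<omega>. tail_noise y i \<omega> * cnj (tail_noise y j \<omega>) \<partial>M)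
     \<le> (\<Sum>s\<in>S i. 1 / real (fst s)) * (\<Sum>s\<in>S j. 1 / real (fst s) * (\<Prod>t\<in>{i+2..j}. norm (step_mean (ty t) (first_phase (fst s) (snd s)))))"
    unfolding tn by (rule norm_expectation_phase_sums_le[OF fin ij]) (simp_all add: norm_first_phase)
  also have "(\<Sum>s\<in>S i. 1 / real (fst s)) \<le> log 2 (real j)"
  proof -
    have "(\<Sum>s\<in>S i. 1 / real (fst s)) = (\<Sum>p\<in>large_factors y i. \<Sum>c\<in>{1..<p}. 1 / real p)"
      unfolding S_def using finite_large_factors[OF i] by (subst sum.Sigma) (auto simp: case_prod_beta)
    also have "\<dots> \<le> (\<Sum>p\<in>large_factors y i. 1)"
    proof (rule sum_mono)
      fix p
      show "(\<Sum>c\<in>{1..<p}. 1 / real p) \<le> 1" by (cases "p = 0") (simp_all add: divide_simps)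
    qed
    also have "\<dots> \<le> log 2 (real i)" using card_large_factors_le[OF i] by simp
    also have "\<dots> \<le> log 2 (real j)" using i ij by simp
    finally show ?thesis .
  qed
  also have "(\<Sum>s\<in>S j. 1 / real (fst s) * (\<Prod>t\<in>{i+2..j}. norm (step_mean (ty t) (first_phase (fst s) (snd s)))))
      \<le> log 2 (real j) * (2 * (1 + ln (real j)) / D)"
  proof -
    have "(\<Sum>s\<in>S j. 1 / real (fst s) * (\<Prod>t\<in>{i+2..j}. norm (step_mean (ty t) (first_phase (fst s) (snd s)))))
      = (\<Sum>p\<in>large_factors y j. \<Sum>c\<in>{1..<p}. 1 / real p * (\<Prod>t\<in>{i+2..j}. norm (step_mean (ty t) (first_phase p c))))"
      unfolding S_def using finite_large_factors[OF j] by (subst sum.Sigma) (auto simp: case_prod_beta)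
    also have "\<dots> \<le> (\<Sum>p\<in>large_factors y j. 2 * (1 + ln (real j)) / D)"
    proof (rule sum_mono)
      fix p assume "p \<in> large_factors y j"
      then have p: "p \<ge> 2" "p \<le> j" using j prime_ge_2_nat by (auto simp: large_factors_def dvd_imp_le)
      have "2 * (1 + ln (real p)) / D \<le> 2 * (1 + ln (real j)) / D"
        using p D by (intro divide_right_mono) auto
      then show "(\<Sum>c\<in>{1..<p}. 1 / real p * (\<Prod>t\<in>{i+2..j}. norm (step_mean (ty t) (first_phase p c)))) \<le> 2 * (1 + ln (real j)) / D"
        using sum_prod_first_phase_le[OF p(1) ij] unfolding D_def by linarith
    qed
    also have "\<dots> = real (card (large_factors y j)) * (2 * (1 + ln (real j)) / D)" by simp
    also have "\<dots> \<le> log 2 (real j) * (2 * (1 + ln (real j)) / D)"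
      using D j by (intro mult_right_mono card_large_factors_le) auto
    finally show ?thesis .
  qed
  finally have "norm (\<integral>\<omega>. tail_noise y i \<omega> * cnj (tail_noise y j \<omega>) \<partial>M)
     \<le> log 2 (real j) * (log 2 (real j) * (2 * (1 + ln (real j)) / D))"
    using j by (simp add: mult_left_mono mult_right_mono sum_nonneg prod_nonneg)
  then show ?thesis by (simp add: D_def power2_eq_square mult_ac)
qed

text \<open>The powers \<open>1/16\<close> and \<open>1/4\<close> allowed by the strong law absorb,
  respectively, the logarithmic size of the noise and the cubed logarithm in its
  covariances.\<close>

lemma averages_to_tail_noise: "AE \<omega> in M. averages_to (\<lambda>i. tail_noise y i \<omega>) 0"
proof -
  have s: "sqrt spread > 0" using spread by simp
  have "(\<lambda>n. (log 2 (real n))\<^sup>2 * (2 * (1 + ln (real n)) / sqrt spread) / real n powr (1/4)) \<longlonglongrightarrow> 0"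
    using s by real_asymp
  then have "Bseq (\<lambda>n. (log 2 (real n))\<^sup>2 * (2 * (1 + ln (real n)) / sqrt spread) / real n powr (1/4))"
    using convergent_imp_Bseq convergentI by blast
  then obtain K1 where K1: "K1 > 0" "\<And>n. norm ((log 2 (real n))\<^sup>2 * (2 * (1 + ln (real n)) / sqrt spread) / real n powr (1/4)) \<le> K1"
    unfolding Bseq_def by blast
  have "(\<lambda>n. log 2 (real n) / real n powr (1/16)) \<longlonglongrightarrow> 0"
    by real_asymp
  then have "Bseq (\<lambda>n. log 2 (real n) / real n powr (1/16))"
    using convergent_imp_Bseq convergentI by blast
  then obtain K2 where K2: "K2 > 0" "\<And>n. norm (log 2 (real n) / real n powr (1/16)) \<le> K2"
    unfolding Bseq_def by blast
  show ?thesis unfolding averages_to_def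
  proof (rule strong_law_weakly_correlated[where K="max K1 K2"])
    show "(\<lambda>\<omega>. tail_noise y i \<omega>) \<in> borel_measurable M" for i
      unfolding tail_noise_def case_prod_beta
      by (intro borel_measurable_sum borel_measurable_times borel_measurable_const phase_measurable)
  next
    fix i \<omega> assume i: "(i::nat) \<ge> 1"
    have "norm (tail_noise y i \<omega>) \<le> log 2 (real i)"
      using norm_tail_noise_le[OF i] card_large_factors_le[OF i] by (rule order_trans)
    also have "\<dots> \<le> K2 * real i powr (1/16)"
      using K2(2)[of i] i by (simp add: pos_divide_le_eq abs_le_iff)
    also have "\<dots> \<le> max K1 K2 * real i powr (1/16)" by (intro mult_right_mono) auto
    finally show "norm (tail_noise y i \<omega>) \<le> max K1 K2 * real i powr (1/16)" .
  next
    fix i j :: nat assume ij: "1 \<le> i" "i < j"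
    have "(log 2 (real j))\<^sup>2 * (2 * (1 + ln (real j)) / sqrt spread) \<le> K1 * real j powr (1/4)"
    proof -
      have "(log 2 (real j))\<^sup>2 * (2 * (1 + ln (real j)) / sqrt spread) / real j powr (1/4) \<le> K1"
        using order_trans[OF abs_ge_self K1(2)[of j, unfolded real_norm_def]] .
      then show ?thesis using ij by (simp only: pos_divide_le_eq powr_gt_zero)
    qed
    also have "\<dots> \<le> max K1 K2 * real j powr (1/4)" by (intro mult_right_mono) auto
    finally have "(log 2 (real j))\<^sup>2 * (2 * (1 + ln (real j)) / sqrt spread) / sqrt (real j - real i)
       \<le> max K1 K2 * real j powr (1/4) / sqrt (real j - real i)"
      using ij by (intro divide_right_mono) auto
    then show "norm (\<integral>\<omega>. tail_noise y i \<omega> * cnj (tail_noise y j \<omega>) \<partial>M)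
       \<le> max K1 K2 * real j powr (1/4) / sqrt (real j - real i)"
      using tail_noise_correlation_le[OF ij] by (rule order_trans[rotated])
  qed
qed

end

section \<open>Consecutive visible points\<close>

lemma sum_inverse_squares_le:
  assumes "y \<ge> 1"
  shows "(\<Sum>d\<in>{y<..n}. 1 / (real d)\<^sup>2) \<le> 1 / real y"
proof (cases "y \<le> n")
  case True
  then have "(\<Sum>d\<in>{y<..n}. 1 / (real d)\<^sup>2) \<le> 1 / real y - 1 / real n"
  proof (induction n rule: nat_induct_at_least)
    case (Suc n)
    have n: "real n > 0" using Suc.hyps assms by simp
    have "1 / (real (Suc n))\<^sup>2 \<le> 1 / (real n * real (Suc n))"
      using n by (intro divide_left_mono) (auto simp: power2_eq_square)
    also have "\<dots> = 1 / real n - 1 / real (Suc n)" using n by (simp add: field_simps)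
    finally have "1 / (real (Suc n))\<^sup>2 \<le> 1 / real n - 1 / real (Suc n)" .
    moreover have "{y<..Suc n} = insert (Suc n) {y<..n}" using Suc.hyps by auto
    ultimately show ?case using Suc.IH by simp
  qed simp
  moreover have "0 \<le> 1 / real n" by simp
  ultimately show ?thesis by linarith
qed simp

lemma card_multiples_le:
  assumes "d \<ge> 1"
  shows "real (card {i \<in> {1..n}. d dvd i}) \<le> real n / real d"
proof -
  have "{i \<in> {1..n}. d dvd i} \<subseteq> (\<lambda>j. d * j) ` {1..n div d}"
  proof
    fix i assume "i \<in> {i \<in> {1..n}. d dvd i}"
    then have i: "1 \<le> i" "i \<le> n" "d dvd i" by auto
    then obtain j where j: "i = d * j" by blast
    have "j \<le> n div d" using i j assms by (metis div_le_mono nonzero_mult_div_cancel_left not_one_le_zero)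
    moreover have "j \<ge> 1" using i j by (cases j) auto
    ultimately show "i \<in> (\<lambda>j. d * j) ` {1..n div d}" using j by auto
  qed
  then have "card {i \<in> {1..n}. d dvd i} \<le> card {1..n div d}"
    by (rule surj_card_le[rotated]) simp
  then have "real (card {i \<in> {1..n}. d dvd i}) \<le> real (n div d)" by simp
  also have "\<dots> \<le> real n / real d" by (rule of_nat_div_le_of_nat)
  finally show ?thesis .
qed

text \<open>A divisor \<open>d\<close> contributes \<open>1/d\<close> at no more than
  \<open>n/d\<close> times, so the average is controlled by the convergent sum of
  \<open>1/d^2\<close>, taken over all integers above \<open>y\<close> instead of primes.\<close>

lemma sum_large_factors_le:
  assumes y: "y \<ge> 1"
  shows "(\<Sum>i\<in>{1..n}. \<Sum>p\<in>large_factors y i. 1 / real p) \<le> real n / real y"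
proof -
  have "(\<Sum>i\<in>{1..n}. \<Sum>p\<in>large_factors y i. 1 / real p)
      \<le> (\<Sum>i\<in>{1..n}. \<Sum>d\<in>{y<..n}. if d dvd i then 1 / real d else 0)"
  proof (rule sum_mono)
    fix i assume i: "i \<in> {1..n}"
    have "(\<Sum>p\<in>large_factors y i. 1 / real p) \<le> (\<Sum>p\<in>{d \<in> {y<..n}. d dvd i}. 1 / real p)"
      using i by (intro sum_mono2) (auto simp: large_factors_def dest: dvd_imp_le)
    then show "(\<Sum>p\<in>large_factors y i. 1 / real p) \<le> (\<Sum>d\<in>{y<..n}. if d dvd i then 1 / real d else 0)"
      by (simp only: sum.inter_filter finite_greaterThanAtMost)
  qed
  also have "\<dots> = (\<Sum>d\<in>{y<..n}. \<Sum>i\<in>{1..n}. if d dvd i then 1 / real d else 0)" by (rule sum.swap)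
  also have "\<dots> = (\<Sum>d\<in>{y<..n}. real (card {i \<in> {1..n}. d dvd i}) * (1 / real d))"
    by (intro sum.cong refl) (simp add: sum.inter_filter[symmetric])
  also have "\<dots> \<le> (\<Sum>d\<in>{y<..n}. real n * (1 / (real d)\<^sup>2))"
  proof (rule sum_mono)
    fix d assume "d \<in> {y<..n}"
    then have "real (card {i \<in> {1..n}. d dvd i}) * (1 / real d) \<le> real n / real d * (1 / real d)"
      using card_multiples_le[of d n] by (intro mult_right_mono) auto
    then show "real (card {i \<in> {1..n}. d dvd i}) * (1 / real d) \<le> real n * (1 / (real d)\<^sup>2)"
      by (simp add: power2_eq_square)
  qed
  also have "\<dots> \<le> real n * (1 / real y)"
    unfolding sum_distrib_left[symmetric] by (intro mult_left_mono sum_inverse_squares_le y) simp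
  finally show ?thesis by simp
qed

text \<open>The constant 8 is 4 from comparing \<open>Rbar\<close> with the sieve average times 2
  from the average number of hits.\<close>

lemma tendsto_of_uniform_approximation:
  fixes A :: "nat \<Rightarrow> nat \<Rightarrow> real"
  assumes A: "\<And>y. y \<ge> 1 \<Longrightarrow> A y \<longlonglongrightarrow> L y" and L: "L \<longlonglongrightarrow> l"
    and R: "\<And>y. y \<ge> 1 \<Longrightarrow> \<forall>\<^sub>F n in sequentially. \<bar>R n - A y n\<bar> \<le> 8 / real y"
  shows "R \<longlonglongrightarrow> l"
proof (rule tendstoI)
  fix e :: real assume e: "e > 0"
  have "\<forall>\<^sub>F y in sequentially. 8 / real y < e / 3"
    using e by real_asymp
  moreover have "\<forall>\<^sub>F y in sequentially. dist (L y) l < e / 3" using tendstoD[OF L, of "e/3"] e by simp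
  moreover have "\<forall>\<^sub>F y in sequentially. y \<ge> (1::nat)" by (rule eventually_ge_at_top)
  ultimately have "\<forall>\<^sub>F y in sequentially. 8 / real y < e / 3 \<and> dist (L y) l < e / 3 \<and> y \<ge> 1"
    by eventually_elim simp
  then obtain y where y: "8 / real y < e / 3" "dist (L y) l < e / 3" "y \<ge> 1"
    using eventually_happens'[OF sequentially_bot] by blast
  have "\<forall>\<^sub>F n in sequentially. dist (A y n) (L y) < e / 3" using tendstoD[OF A[OF y(3)], of "e/3"] e by simp
  then show "\<forall>\<^sub>F n in sequentially. dist (R n) l < e"
    using R[OF y(3)]
  proof eventually_elim
    case (elim n)
    then show ?case using y unfolding dist_real_def by linarith
  qed
qed

definition sieving_primes :: "nat \<Rightarrow> nat set" where
  "sieving_primes y = {p. prime p \<and> p \<le> y}"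

lemma finite_sieving_primes: "finite (sieving_primes y)"
  unfolding sieving_primes_def by (rule finite_subset[of _ "{..y}"]) auto

lemma prime_prod_tendsto:
  assumes "k \<ge> 2"
  shows "(\<lambda>y. \<Prod>p\<in>sieving_primes y. 1 - 2 / real p ^ k) \<longlonglongrightarrow> prime_prod k"
proof -
  define f where "f p = (if prime p then 1 - 2 / real p ^ k else 1)" for p :: nat
  have "summable (\<lambda>p. norm (f p - 1))"
  proof (rule summable_comparison_test')
    show "summable (\<lambda>n. 2 * inverse (real n ^ k))"
      using assms by (intro summable_mult inverse_power_summable)
    show "norm (norm (f n - 1)) \<le> 2 * inverse (real n ^ k)" if "n \<ge> 0" for n
      by (simp add: f_def divide_inverse abs_mult)
  qed
  then have "convergent_prod f"
    by (intro abs_convergent_prod_imp_convergent_prod summable_imp_abs_convergent_prod)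
  then have "(\<lambda>y. \<Prod>p\<le>y. f p) \<longlonglongrightarrow> prodinf f" by (rule convergent_prod_LIMSEQ)
  moreover have "(\<Prod>p\<le>y. f p) = (\<Prod>p\<in>sieving_primes y. 1 - 2 / real p ^ k)" for y
    unfolding f_def sieving_primes_def by (intro prod.mono_neutral_cong_right) auto
  ultimately show ?thesis by (simp add: prime_prod_def f_def[abs_def])
qed

lemma one_minus_two_over_pow_nonzero:
  assumes "k \<ge> 2" "p \<ge> 2"
  shows "1 - 2 / real p ^ k \<noteq> 0"
proof -
  have "real p ^ 2 \<le> real p ^ k" using assms by (intro power_increasing) auto
  moreover have "2 ^ 2 \<le> real p ^ 2" using assms by (intro power_mono) auto
  ultimately have "real p ^ k \<ge> 4" by simp
  then show ?thesis by (auto simp: field_simps)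
qed

section \<open>Comparing visibility with the sieve\<close>

context random_walk
begin

definition all_dvd :: "nat \<Rightarrow> nat \<Rightarrow> 'w \<Rightarrow> bool" where
  "all_dvd p i \<omega> \<longleftrightarrow> (\<forall>l<k. p dvd card {t \<in> {1..i}. W t \<omega> = l})"

lemma sum_coords:
  assumes "\<omega> \<in> space M"
  shows "(\<Sum>l<k. card {t \<in> {1..i}. W t \<omega> = l}) = i"
proof -
  have "(\<Sum>l<k. card {t \<in> {1..i}. W t \<omega> = l}) = (\<Sum>l<k. \<Sum>t\<in>{1..i}. if W t \<omega> = l then 1 else 0)"
    by (intro sum.cong refl) (simp add: sum.inter_filter[symmetric])
  also have "\<dots> = (\<Sum>t\<in>{1..i}. \<Sum>l<k. if W t \<omega> = l then 1 else 0)" by (rule sum.swap)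
  also have "\<dots> = (\<Sum>t\<in>{1..i}. 1)"
    using W_less assms by (intro sum.cong refl) simp
  finally show ?thesis by simp
qed

lemma all_dvd_imp_dvd:
  assumes "\<omega> \<in> space M" "all_dvd p i \<omega>"
  shows "p dvd i"
proof -
  have "p dvd (\<Sum>l<k. card {t \<in> {1..i}. W t \<omega> = l})"
    using assms by (intro dvd_sum) (auto simp: all_dvd_def)
  then show ?thesis unfolding sum_coords[OF assms(1)] .
qed

lemma visible_iff: "visible k (walk_pos W i \<omega>) \<longleftrightarrow> (\<forall>p. prime p \<longrightarrow> \<not> all_dvd p i \<omega>)"
proof -
  define V where "V = walk_pos W i \<omega> ` {..<k}"
  have dvd_iff: "int p dvd Gcd V \<longleftrightarrow> all_dvd p i \<omega>" for p
    unfolding V_def dvd_Gcd_iff all_dvd_def by (simp add: walk_pos_def, simp add: Ball_def)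
  have "Gcd V = 1 \<longleftrightarrow> (\<forall>p. prime p \<longrightarrow> \<not> int p dvd Gcd V)"
  proof
    assume "Gcd V = 1"
    then show "\<forall>p. prime p \<longrightarrow> \<not> int p dvd Gcd V" using not_prime_1 by auto
  next
    assume *: "\<forall>p. prime p \<longrightarrow> \<not> int p dvd Gcd V"
    show "Gcd V = 1"
    proof (rule ccontr)
      have nn: "Gcd V \<ge> 0" by simp
      assume "Gcd V \<noteq> 1"
      then have "nat (Gcd V) \<noteq> 1" using nn by linarith
      then obtain p where "prime p" "p dvd nat (Gcd V)" using prime_factor_nat by blast
      then have "int p dvd Gcd V" using nn by (metis int_dvd_int_iff nat_0_le)
      with * \<open>prime p\<close> show False by blast
    qed
  qed
  then show ?thesis unfolding visible_def V_def[symmetric] dvd_iff .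
qed

lemma all_dvd_Suc_exclusive:
  assumes "\<omega> \<in> space M" "p \<ge> 2" "all_dvd p i \<omega>" "all_dvd p (i + 1) \<omega>"
  shows False
proof -
  have "p dvd i" "p dvd i + 1" using all_dvd_imp_dvd assms by blast+
  then have "p dvd 1" using dvd_add_right_iff[of p i 1] by simp
  then show False using assms(2) by simp
qed

lemma sieve_eq_indicator:
  assumes "finite P" "\<And>p. p \<in> P \<Longrightarrow> prime p" "\<omega> \<in> space M"
  shows "sieve P i \<omega> = (if \<forall>p\<in>P. \<not> all_dvd p i \<omega> \<and> \<not> all_dvd p (i+1) \<omega> then 1 else 0)"
  using assms(1,2)
proof (induction P)
  case (insert p P)
  have "p \<ge> 2" using insert.prems prime_ge_2_nat by blast
  then have "1 - coords_dvd p i \<omega> - coords_dvd p (i+1) \<omega> = (if \<not> all_dvd p i \<omega> \<and> \<not> all_dvd p (i+1) \<omega> then 1 else 0)"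
    using all_dvd_Suc_exclusive[OF assms(3), of p i]
    unfolding coords_dvd_def all_dvd_def[symmetric] by auto
  moreover have "sieve (insert p P) i \<omega> = (1 - coords_dvd p i \<omega> - coords_dvd p (i+1) \<omega>) * sieve P i \<omega>"
    using insert.hyps by (simp add: sieve_def)
  ultimately show ?case using insert.IH insert.prems by simp
qed (simp add: sieve_def)

lemma all_dvd_imp_hits:
  assumes \<omega>: "\<omega> \<in> space M" and i: "i \<ge> 1"
    and p: "prime p" "y < p" "all_dvd p i \<omega>"
  shows "first_coord_hits y i \<omega> \<ge> 1"
proof -
  have "p \<in> {p \<in> large_factors y i. p dvd card {t \<in> {1..i}. W t \<omega> = 0}}"
    using p all_dvd_imp_dvd[OF \<omega> p(3)] k_ge_2 by (simp add: large_factors_def all_dvd_def)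
  moreover have "finite {p \<in> large_factors y i. p dvd card {t \<in> {1..i}. W t \<omega> = 0}}"
    using finite_large_factors[OF i] by simp
  ultimately have "card {p \<in> large_factors y i. p dvd card {t \<in> {1..i}. W t \<omega> = 0}} > 0"
    unfolding card_gt_0_iff by blast
  then show ?thesis unfolding first_coord_hits_def by simp
qed

text \<open>The two sides differ only if the sieve passes but some prime outside \<open>P\<close>
  divides one of the positions; that prime exceeds \<open>y\<close> and is counted as a hit.
  \<open>P\<close> may be larger than the primes up to \<open>y\<close>, as the prime of the modulus
  may exceed \<open>y\<close>.\<close>

lemma sieve_minus_visible_le:
  assumes \<omega>: "\<omega> \<in> space M" and i: "i \<ge> 1"
    and P: "finite P" "\<And>p. p \<in> P \<Longrightarrow> prime p" "sieving_primes y \<subseteq> P"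
  shows "\<bar>Re (sieve P i \<omega>) - Xvis k W i \<omega> * Xvis k W (i+1) \<omega>\<bar>
    \<le> real (first_coord_hits y i \<omega>) + real (first_coord_hits y (i+1) \<omega>)"
proof (cases "visible k (walk_pos W i \<omega>) \<and> visible k (walk_pos W (i+1) \<omega>)")
  case True
  then have "\<forall>p\<in>P. \<not> all_dvd p i \<omega> \<and> \<not> all_dvd p (i+1) \<omega>" using P(2) unfolding visible_iff by blast
  then show ?thesis using True by (simp add: sieve_eq_indicator[OF P(1,2) \<omega>] Xvis_def)
next
  case False
  then have X: "Xvis k W i \<omega> * Xvis k W (i+1) \<omega> = 0" by (auto simp: Xvis_def)
  show ?thesis
  proof (cases "\<forall>p\<in>P. \<not> all_dvd p i \<omega> \<and> \<not> all_dvd p (i+1) \<omega>")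
    case ok: True
    obtain p where p: "prime p" "all_dvd p i \<omega> \<or> all_dvd p (i+1) \<omega>"
      using False unfolding visible_iff by blast
    then have "p \<notin> P" using ok by blast
    then have "y < p" using P(3) p(1) by (auto simp: sieving_primes_def)
    then have "first_coord_hits y i \<omega> \<ge> 1 \<or> first_coord_hits y (i+1) \<omega> \<ge> 1"
      using all_dvd_imp_hits[OF \<omega> _ p(1), of _ y] p(2) i by auto
    then have "1 \<le> first_coord_hits y i \<omega> + first_coord_hits y (i+1) \<omega>" by linarith
    then have "real 1 \<le> real (first_coord_hits y i \<omega> + first_coord_hits y (i+1) \<omega>)"
      by (simp only: of_nat_le_iff)
    then show ?thesis unfolding X using ok by (simp add: sieve_eq_indicator[OF P(1,2) \<omega>])
  next
    case bad: False
    then have "sieve P i \<omega> = 0" by (simp only: sieve_eq_indicator[OF P(1,2) \<omega>] if_False)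
    then show ?thesis unfolding X by simp
  qed
qed

text \<open>One \<open>1 / y\<close> bounds the deterministic sum of \<open>1/p\<close>, the other
  the noise average, which is eventually that small.\<close>

lemma eventually_average_hits_le:
  assumes y: "y \<ge> 1" and noise: "averages_to (\<lambda>i. tail_noise y i \<omega>) 0"
  shows "\<forall>\<^sub>F n in sequentially. (\<Sum>i\<in>{1..n}. real (first_coord_hits y i \<omega>)) / real n \<le> 2 / real y"
proof -
  have "\<forall>\<^sub>F n in sequentially. dist ((\<Sum>i\<in>{1..n}. tail_noise y i \<omega>) / of_nat n) 0 < 1 / real y"
    using tendstoD[OF noise[unfolded averages_to_def], of "1 / real y"] y by simp
  then show ?thesis
  proof eventually_elim
    case (elim n)
    have "real (first_coord_hits y i \<omega>) = Re (tail_noise y i \<omega>) + (\<Sum>p\<in>large_factors y i. 1 / real p)"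
      if "i \<in> {1..n}" for i
    proof -
      have "i \<ge> 1" using that by simp
      from arg_cong[OF first_coord_hits_eq[OF this, of y \<omega>], of Re] show ?thesis by simp
    qed
    then have "(\<Sum>i\<in>{1..n}. real (first_coord_hits y i \<omega>)) / real n
        = (\<Sum>i\<in>{1..n}. Re (tail_noise y i \<omega>)) / real n + (\<Sum>i\<in>{1..n}. \<Sum>p\<in>large_factors y i. 1 / real p) / real n"
      by (simp add: sum.distrib add_divide_distrib)
    also have "(\<Sum>i\<in>{1..n}. Re (tail_noise y i \<omega>)) / real n = Re ((\<Sum>i\<in>{1..n}. tail_noise y i \<omega>) / of_nat n)"
      by (simp add: Re_divide_of_nat)
    also have "\<dots> \<le> 1 / real y"
      using complex_Re_le_cmod[of "(\<Sum>i\<in>{1..n}. tail_noise y i \<omega>) / of_nat n"] elim by (simp add: dist_norm)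
    also have "(\<Sum>i\<in>{1..n}. \<Sum>p\<in>large_factors y i. 1 / real p) / real n \<le> (real n / real y) / real n"
      by (intro divide_right_mono sum_large_factors_le y) simp
    also have "(real n / real y) / real n \<le> 1 / real y" by (cases "n = 0") simp_all
    finally show ?case by simp
  qed
qed

text \<open>The factor 4 arises because every hit is counted at most twice, for \<open>i\<close> and
  for \<open>i + 1\<close>, and because \<open>1 / n\<close> is at most
  \<open>2 / (n + 1)\<close>.\<close>

lemma Rbar_minus_sieve_average_le:
  assumes \<omega>: "\<omega> \<in> space M" and n: "n \<ge> 1"
    and P: "finite P" "\<And>p. p \<in> P \<Longrightarrow> prime p" "sieving_primes y \<subseteq> P"
  shows "\<bar>Rbar k W n a m \<omega> - Re ((\<Sum>i\<in>{1..n}. class_ind a m i * sieve P i \<omega>) / of_nat n)\<bar>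
    \<le> 4 * ((\<Sum>i\<in>{1..Suc n}. real (first_coord_hits y i \<omega>)) / real (Suc n))"
proof -
  define X U where "X i = Xvis k W i \<omega> * Xvis k W (i+1) \<omega>" and "U i = real (first_coord_hits y i \<omega>)" for i
  define c where "c i = (if i mod m = a mod m then 1 else 0 :: real)" for i
  have 1: "Rbar k W n a m \<omega> = (\<Sum>i\<in>{1..n}. c i * X i) / real n"
  proof -
    have "(\<Sum>i\<in>{i \<in> {1..n}. i mod m = a mod m}. X i) = (\<Sum>i\<in>{1..n}. if i mod m = a mod m then X i else 0)"
      by (rule sum.inter_filter) simp
    also have "\<dots> = (\<Sum>i\<in>{1..n}. c i * X i)" by (intro sum.cong refl) (simp add: c_def)
    finally show ?thesis unfolding Rbar_def X_def by simp
  qed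
  have 2: "Re ((\<Sum>i\<in>{1..n}. class_ind a m i * sieve P i \<omega>) / of_nat n) = (\<Sum>i\<in>{1..n}. c i * Re (sieve P i \<omega>)) / real n"
    by (simp add: Re_divide_of_nat class_ind_def c_def if_distrib[of "\<lambda>x. x * _"] if_distrib[of Re] cong: if_cong)
  have "\<bar>(\<Sum>i\<in>{1..n}. c i * X i) - (\<Sum>i\<in>{1..n}. c i * Re (sieve P i \<omega>))\<bar> = \<bar>\<Sum>i\<in>{1..n}. c i * (X i - Re (sieve P i \<omega>))\<bar>"
    by (simp add: sum_subtractf right_diff_distrib)
  also have "\<dots> \<le> (\<Sum>i\<in>{1..n}. \<bar>c i * (X i - Re (sieve P i \<omega>))\<bar>)" by (rule sum_abs)
  also have "\<dots> \<le> (\<Sum>i\<in>{1..n}. U i + U (i+1))"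
  proof (rule sum_mono)
    fix i assume "i \<in> {1..n}"
    then have "\<bar>X i - Re (sieve P i \<omega>)\<bar> \<le> U i + U (i+1)"
      using sieve_minus_visible_le[OF \<omega> _ P, of i] by (simp add: X_def U_def abs_minus_commute)
    moreover have "0 \<le> U i + U (i+1)" by (simp add: U_def)
    ultimately show "\<bar>c i * (X i - Re (sieve P i \<omega>))\<bar> \<le> U i + U (i+1)" by (simp add: c_def)
  qed
  also have "\<dots> = (\<Sum>i\<in>{1..n}. U i) + (\<Sum>i\<in>{2..Suc n}. U i)"
    unfolding sum.distrib by (simp add: sum.shift_bounds_cl_Suc_ivl[symmetric] numeral_2_eq_2)
  also have "\<dots> \<le> (\<Sum>i\<in>{1..Suc n}. U i) + (\<Sum>i\<in>{1..Suc n}. U i)"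
    by (intro add_mono sum_mono2) (auto simp: U_def)
  finally have *: "\<bar>(\<Sum>i\<in>{1..n}. c i * X i) - (\<Sum>i\<in>{1..n}. c i * Re (sieve P i \<omega>))\<bar> \<le> 2 * (\<Sum>i\<in>{1..Suc n}. U i)"
    by simp
  define S where "S = (\<Sum>i\<in>{1..Suc n}. U i)"
  have S: "S \<ge> 0" unfolding S_def U_def by (intro sum_nonneg) simp
  have "\<bar>Rbar k W n a m \<omega> - Re ((\<Sum>i\<in>{1..n}. class_ind a m i * sieve P i \<omega>) / of_nat n)\<bar> \<le> 2 * S / real n"
    unfolding 1 2 diff_divide_distrib[symmetric] abs_divide using * n
    by (simp add: S_def divide_right_mono)
  also have "\<dots> \<le> 4 * (S / real (Suc n))"
  proof -
    have "2 * S * real (Suc n) \<le> 4 * S * real n"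
      using S n mult_left_mono[of "real (Suc n)" "2 * real n" "2 * S"] by (simp add: algebra_simps)
    then show ?thesis using n by (simp add: divide_simps)
  qed
  finally show ?thesis by (simp only: S_def U_def)
qed

definition class_density :: "nat \<Rightarrow> nat \<Rightarrow> real" where
  "class_density p a = 1 - ((if p dvd a then 1 else 0) + (if p dvd a + 1 then 1 else 0)) / real p ^ (k-1)"

lemma Rbar_prime_power_tendsto:
  assumes p: "prime p" and r: "r \<ge> 1"
  shows "AE \<omega> in M. (\<lambda>n. Rbar k W n a (p^r) \<omega>) \<longlonglongrightarrow>
     class_density p a / (real p ^ r * (1 - 2 / real p ^ k)) * prime_prod k"
proof -
  define m where "m = p ^ r"
  \<comment> \<open>The prime \<open>p\<close> is removed so that the modulus is coprime to all of
    \<open>Q y\<close>, and reinserted last, when its density is constant on the class.\<close>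
  define Q where "Q y = sieving_primes y - {p}" for y
  define L where "L y = class_density p a / real m * (\<Prod>q\<in>Q y. 1 - 2 / real q ^ k)" for y
  have p2: "p \<ge> 2" using p by (rule prime_ge_2_nat)
  have Q: "finite (Q y)" "q \<in> Q y \<Longrightarrow> prime q" for q y
    using finite_sieving_primes by (auto simp: Q_def sieving_primes_def)
  have P: "finite (insert p (Q y))" "q \<in> insert p (Q y) \<Longrightarrow> prime q" "sieving_primes y \<subseteq> insert p (Q y)" for q y
    using Q p by (auto simp: Q_def)
  have cop: "coprime m q" if "q \<in> Q y" for q y
    using that p primes_coprime[of p q] unfolding m_def Q_def sieving_primes_def by simp
  have m: "m \<ge> 1" "p dvd m" using p2 r by (auto simp: m_def)
  have lim: "local_density p a * (1 / of_nat m * (\<Prod>q\<in>Q y. 1 - 2 / of_nat q ^ k)) = of_real (L y)" for y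
    by (simp add: L_def local_density_def class_density_def)
  have sieve_lim: "AE \<omega> in M. averages_to (\<lambda>i. class_ind a m i * sieve (insert p (Q y)) i \<omega>) (of_real (L y))" for y
    unfolding lim[symmetric] by (rule averages_to_sieved_class_dvd[OF Q m(1) cop p m(2)])
  have L_lim: "L \<longlonglongrightarrow> class_density p a / real m * (prime_prod k / (1 - 2 / real p ^ k))"
    unfolding L_def
  proof (intro tendsto_mult tendsto_const)
    have nz: "1 - 2 / real p ^ k \<noteq> 0" by (rule one_minus_two_over_pow_nonzero[OF k_ge_2 p2])
    have "(\<lambda>y. (\<Prod>q\<in>sieving_primes y. 1 - 2 / real q ^ k) / (1 - 2 / real p ^ k))
        \<longlonglongrightarrow> prime_prod k / (1 - 2 / real p ^ k)"
      by (intro tendsto_divide prime_prod_tendsto k_ge_2 tendsto_const nz)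
    \<comment> \<open>Once \<open>y \<ge> p\<close>, the factor at \<open>p\<close> occurs in the
      full product and can be divided out.\<close>
    moreover have "\<forall>\<^sub>F y in sequentially. (\<Prod>q\<in>sieving_primes y. 1 - 2 / real q ^ k) / (1 - 2 / real p ^ k)
        = (\<Prod>q\<in>Q y. 1 - 2 / real q ^ k)"
      using eventually_ge_at_top[of p]
    proof eventually_elim
      case (elim y)
      then have "p \<in> sieving_primes y" using p by (simp add: sieving_primes_def)
      from prod.remove[OF finite_sieving_primes this, of "\<lambda>q. 1 - 2 / real q ^ k"]
      show ?case using nz by (simp add: Q_def)
    qed
    ultimately show "(\<lambda>y. \<Prod>q\<in>Q y. 1 - 2 / real q ^ k) \<longlonglongrightarrow> prime_prod k / (1 - 2 / real p ^ k)"
      by (rule Lim_transform_eventually)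
  qed
  \<comment> \<open>There are countably many cutoffs \<open>y\<close>, so one null set serves all of
    them before \<open>y\<close> grows.\<close>
  have "AE \<omega> in M. \<forall>y. averages_to (\<lambda>i. class_ind a m i * sieve (insert p (Q y)) i \<omega>) (of_real (L y))"
    unfolding AE_all_countable using sieve_lim by blast
  moreover have "AE \<omega> in M. \<forall>y. averages_to (\<lambda>i. tail_noise y i \<omega>) 0"
    unfolding AE_all_countable using averages_to_tail_noise by blast
  ultimately show ?thesis using AE_space
  proof eventually_elim
    case (elim \<omega>)
    define Av where "Av y n = Re ((\<Sum>i\<in>{1..n}. class_ind a m i * sieve (insert p (Q y)) i \<omega>) / of_nat n)" for y n
    have "(\<lambda>n. Rbar k W n a m \<omega>) \<longlonglongrightarrow> class_density p a / real m * (prime_prod k / (1 - 2 / real p ^ k))"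
    proof (rule tendsto_of_uniform_approximation[OF _ L_lim])
      show "Av y \<longlonglongrightarrow> L y" for y
        using tendsto_Re[OF elim(1)[rule_format, of y, unfolded averages_to_def]] by (simp add: Av_def[abs_def])
      show "\<forall>\<^sub>F n in sequentially. \<bar>Rbar k W n a m \<omega> - Av y n\<bar> \<le> 8 / real y" if y: "y \<ge> 1" for y
      proof -
        have "\<forall>\<^sub>F n in sequentially. (\<Sum>i\<in>{1..Suc n}. real (first_coord_hits y i \<omega>)) / real (Suc n) \<le> 2 / real y"
          using eventually_average_hits_le[OF y elim(2)[rule_format, of y]]
          by (rule eventually_compose_filterlim[OF _ filterlim_Suc])
        then show ?thesis using eventually_ge_at_top[of 1]
        proof eventually_elim
          case (elim n)
          have "\<bar>Rbar k W n a m \<omega> - Av y n\<bar> \<le> 4 * ((\<Sum>i\<in>{1..Suc n}. real (first_coord_hits y i \<omega>)) / real (Suc n))"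
            unfolding Av_def by (rule Rbar_minus_sieve_average_le[OF \<open>\<omega> \<in> space M\<close> elim(2) P])
          also have "\<dots> \<le> 4 * (2 / real y)" by (intro mult_left_mono elim(1)) simp
          finally show ?case by simp
        qed
      qed
    qed
    then show ?case by (simp add: m_def)
  qed
qed

end

theorem theorem1p4:
  fixes M :: "'w measure" and k q :: nat and A :: "(nat \<Rightarrow> real) set"
    and ty :: "nat \<Rightarrow> (nat \<Rightarrow> real)" and W :: "nat \<Rightarrow> 'w \<Rightarrow> nat"
  assumes "prob_space M"
    and "k \<ge> 2" and "q \<ge> 1"
    and "finite A" and "card A = q"
    and "\<forall>\<alpha>\<in>A. (\<forall>j<k. 0 < \<alpha> j \<and> \<alpha> j < 1) \<and> (\<Sum>j<k. \<alpha> j) = 1"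
    and "\<forall>i\<ge>1. ty i \<in> A"
    and "\<forall>i\<ge>1. W i \<in> measurable M (count_space UNIV)"
    and "\<forall>i\<ge>1. \<forall>\<omega>\<in>space M. W i \<omega> < k"
    and "prob_space.indep_vars M (\<lambda>_. count_space UNIV) W {1..}"
    and "\<forall>i\<ge>1. \<forall>j<k. measure M {\<omega> \<in> space M. W i \<omega> = j} = ty i j"
  shows "(\<forall>r\<ge>1. \<forall>a<2^r. AE \<omega> in M.
            (\<lambda>n. Rbar k W n a (2^r) \<omega>) \<longlonglongrightarrow> prime_prod k / 2^r)
       \<and> (\<forall>p1::nat. prime p1 \<and> p1 \<ge> 3 \<longrightarrow> (\<forall>a<p1. AE \<omega> in M.
            (\<lambda>n. Rbar k W n a p1 \<omega>) \<longlonglongrightarrow>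
              (if a = 0 \<or> a = p1 - 1
               then (real p1 ^ (k - 1) - 1) / (real p1 ^ k - 2)
               else real p1 ^ (k - 1) / (real p1 ^ k - 2)) * prime_prod k))"
proof -
  interpret prob_space M by fact
  interpret random_walk M k A ty W
    by unfold_locales (use assms in blast)+
  obtain k' where k': "k = Suc k'" using k_ge_2 by (cases k) auto
  have two: "AE \<omega> in M. (\<lambda>n. Rbar k W n a (2^r) \<omega>) \<longlonglongrightarrow> prime_prod k / 2^r" if "r \<ge> 1" for r a
  proof -
    \<comment> \<open>Exactly one of \<open>a\<close> and \<open>a + 1\<close> is even, so the
      density at 2 is the same for every class and cancels the Euler factor at 2.\<close>
    have "class_density 2 a = 1 - 2 / 2 ^ k"
      unfolding class_density_def by (cases "even a") (simp_all add: k')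
    moreover have "1 - 2 / real 2 ^ k \<noteq> 0" by (rule one_minus_two_over_pow_nonzero[OF k_ge_2]) simp
    ultimately have "class_density 2 a / (real 2 ^ r * (1 - 2 / real 2 ^ k)) * prime_prod k = prime_prod k / 2 ^ r"
      by simp
    then show ?thesis using Rbar_prime_power_tendsto[OF two_is_prime_nat that, of a] by simp
  qed
  have odd: "AE \<omega> in M. (\<lambda>n. Rbar k W n a p \<omega>) \<longlonglongrightarrow>
      (if a = 0 \<or> a = p - 1 then (real p ^ (k - 1) - 1) / (real p ^ k - 2)
       else real p ^ (k - 1) / (real p ^ k - 2)) * prime_prod k"
    if p: "prime p" "p \<ge> 3" and a: "a < p" for p a
  proof -
    have nz: "1 - 2 / real p ^ k \<noteq> 0" using one_minus_two_over_pow_nonzero[OF k_ge_2] p by simp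
    have p0: "real p > 0" using p by simp
    \<comment> \<open>Since \<open>a < p\<close>, the residues 0 and \<open>p - 1\<close> are the
      only special ones; elsewhere the density at \<open>p\<close> is 1.\<close>
    have d1: "p dvd a \<longleftrightarrow> a = 0" using a by (auto dest: dvd_imp_le)
    have d2: "p dvd a + 1 \<longleftrightarrow> a = p - 1" using a by (auto dest: dvd_imp_le)
    have "real p ^ k - 2 \<noteq> 0" using nz p0 by (auto simp: field_simps)
    then have "class_density p a / (real p ^ 1 * (1 - 2 / real p ^ k)) =
      (if a = 0 \<or> a = p - 1 then (real p ^ (k - 1) - 1) / (real p ^ k - 2)
       else real p ^ (k - 1) / (real p ^ k - 2))"
      using p p0 unfolding class_density_def d1 d2 by (auto simp: k' field_simps)
    then show ?thesis using Rbar_prime_power_tendsto[OF p(1), of 1 a] by simp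
  qed
  from two odd show ?thesis by blast
qed

end
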